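(* Let $n\ge 3$, $p\ge 1$, and let $M^n$ be an $n$-dimensional Riemannian submanifold of an $(n+p)$-dimensional real space form $N^{n+p}(\widetilde c)$ of constant sectional curvature $\widetilde c$. (i) If $M$ is a Casorati ideal submanifold for the inequality $\rho\le\hat\delta_c(n-1)+\widetilde c$ (that is, equality $\rho=\hat\delta_c(n-1)+\widetilde c$ holds at every point of $M$), then $M$ is Einstein if and only if $M$ is totally geodesic. (ii) If $M$ is a Casorati ideal submanifold for the inequality $\rho\le\delta_C(n-1)+\widetilde c$ (that is, equality $\rho=\delta_C(n-1)+\widetilde c$ holds at every point of $M$), then $M$ is Einstein if and only if $M$ is totally geodesic.
   Context: $M^n$ carries the induced metric; $h$ is its second fundamental form, and $M$ is totally geodesic if $h=0$. For an orthonormal frame $e_1,\dots,e_n$ tangent to $M$ and $e_{n+1},\dots,e_{n+p}$ normal to $M$, put $h_{ij}^r=\overline g(h(e_i,e_j),e_r)$, where $\overline g$ is the metric of $N^{n+p}(\widetilde c)$. The Casorati curvature of $M$ is $$\mathcal C=\frac1n\sum_{r=n+1}^{n+p}\sum_{i,j=1}^n (h_{ij}^r)^2 .$$ For an $l$-dimensional subspace $L\subset T_xM$, $l\ge 2$, with orthonormal basis $e_1,\dots,e_l$, its Casorati curvature is $$\mathcal C(L)=\frac1l\sum_{r=n+1}^{n+p}\sum_{i,j=1}^l (h_{ij}^r)^2 .$$ The normalized $\delta$-Casorati curvatures are defined at $x\in M$ by $$[\hat\delta_c(n-1)]_x=2\,\mathcal C_x-\frac{2n-1}{2n}\sup\{\mathcal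 C(L)\mid L\text{ a hyperplane of }T_xM\},$$ $$[\delta_C(n-1)]_x=\tfrac12\,\mathcal C_x+\frac{n+1}{2n}\inf\{\mathcal C(L)\mid L\text{ a hyperplane of }T_xM\}.$$ The scalar curvature is $\tau=\sum_{i<j}K(e_i\wedge e_j)$, where $K$ is the sectional curvature of $M$, and the normalized scalar curvature is $\rho=\frac{2\tau}{n(n-1)}$. Both inequalities $\rho\le\hat\delta_c(n-1)+\widetilde c$ and $\rho\le\delta_C(n-1)+\widetilde c$ hold for every such submanifold. *)

theory Defs
  imports "HOL-Analysis.Analysis"
begin

section \<open>Smooth manifolds and smooth maps\<close>

text \<open>On a finite-dimensional space, continuity of all iterated directional derivatives of a
  differentiable map is the usual notion of a map of class C^k.\<close>

primrec Ck_on :: "nat \<Rightarrow> 'e::euclidean_space set \<Rightarrow> ('e \<Rightarrow> 'f::real_normed_vector) \<Rightarrow> bool" where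
  "Ck_on 0 S F \<longleftrightarrow> continuous_on S F"
| "Ck_on (Suc k) S F \<longleftrightarrow>
     (\<forall>x\<in>S. F differentiable (at x)) \<and>
     (\<forall>v. Ck_on k S (\<lambda>x. frechet_derivative F (at x) v))"

definition smooth_on :: "'e::euclidean_space set \<Rightarrow> ('e \<Rightarrow> 'f::real_normed_vector) \<Rightarrow> bool" where
  "smooth_on S F \<longleftrightarrow> (\<forall>k. Ck_on k S F)"

type_synonym ('a, 'e) chart = "'a set \<times> ('a \<Rightarrow> 'e)"

definition is_chart :: "('a::topological_space, 'e::euclidean_space) chart \<Rightarrow> bool" where
  "is_chart \<kappa> \<longleftrightarrow> open (fst \<kappa>) \<and> open (snd \<kappa> ` fst \<kappa>) \<and>
     (\<exists>\<psi>. homeomorphism (fst \<kappa>) (snd \<kappa> ` fst \<kappa>) (snd \<kappa>) \<psi>)"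

text \<open>The coordinate expression of a map \<open>f\<close> in the charts \<open>\<kappa>\<close> and \<open>\<kappa>'\<close>, and the set of
  coordinates on which it is meaningful.\<close>

definition chart_rep ::
    "('a, 'e) chart \<Rightarrow> ('b, 'f) chart \<Rightarrow> ('a \<Rightarrow> 'b) \<Rightarrow> 'e \<Rightarrow> 'f" where
  "chart_rep \<kappa> \<kappa>' f = (\<lambda>x. snd \<kappa>' (f (inv_into (fst \<kappa>) (snd \<kappa>) x)))"

definition rep_domain ::
    "('a, 'e) chart \<Rightarrow> ('b, 'f) chart \<Rightarrow> ('a \<Rightarrow> 'b) \<Rightarrow> 'e set" where
  "rep_domain \<kappa> \<kappa>' f = snd \<kappa> ` {q \<in> fst \<kappa>. f q \<in> fst \<kappa>'}"

text \<open>The manifold given by an atlas is the union of the chart domains, an open subset of a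
  Hausdorff second countable space; its dimension is that of the model space \<open>'e\<close>.\<close>

definition manifold_carrier :: "('a, 'e) chart set \<Rightarrow> 'a set" where
  "manifold_carrier A = (\<Union>\<kappa>\<in>A. fst \<kappa>)"

definition smooth_atlas ::
    "('a::{t2_space,second_countable_topology}, 'e::euclidean_space) chart set \<Rightarrow> bool" where
  "smooth_atlas A \<longleftrightarrow> (\<forall>\<kappa>\<in>A. is_chart \<kappa>) \<and>
     (\<forall>\<kappa>\<in>A. \<forall>\<kappa>'\<in>A. smooth_on (rep_domain \<kappa> \<kappa>' id) (chart_rep \<kappa> \<kappa>' id))"

definition smooth_map ::
    "('a::{t2_space,second_countable_topology}, 'e::euclidean_space) chart set \<Rightarrow>
     ('b::{t2_space,second_countable_topology}, 'f::euclidean_space) chart set \<Rightarrow>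
     ('a \<Rightarrow> 'b) \<Rightarrow> bool" where
  "smooth_map A B f \<longleftrightarrow>
     f ` manifold_carrier A \<subseteq> manifold_carrier B \<and>
     continuous_on (manifold_carrier A) f \<and>
     (\<forall>\<kappa>\<in>A. \<forall>\<kappa>'\<in>B. smooth_on (rep_domain \<kappa> \<kappa>' f) (chart_rep \<kappa> \<kappa>' f))"

section \<open>Riemannian geometry in a coordinate domain\<close>

text \<open>A metric in coordinates is a map \<open>G\<close> sending a coordinate point \<open>x\<close> to an inner product on
  the tangent space at \<open>x\<close>, which the chart identifies with the model space \<open>'e\<close>. The inner
  product of the class \<open>euclidean_space\<close> plays no geometric role.\<close>

type_synonym 'e local_metric = "'e \<Rightarrow> 'e \<Rightarrow> 'e \<Rightarrow> real"

definition inner_product_form :: "('e::real_vector \<Rightarrow> 'e \<Rightarrow> real) \<Rightarrow> bool" where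
  "inner_product_form b \<longleftrightarrow>
     (\<forall>u. linear (b u)) \<and> (\<forall>u v. b u v = b v u) \<and> (\<forall>u. u \<noteq> 0 \<longrightarrow> 0 < b u u)"

text \<open>The covariant derivative of the coordinate-constant field \<open>v\<close> in direction \<open>u\<close> for the
  Levi-Civita connection, characterised by Koszul's formula (constant fields commute).\<close>

definition christoffel :: "'e::euclidean_space local_metric \<Rightarrow> 'e \<Rightarrow> 'e \<Rightarrow> 'e \<Rightarrow> 'e" where
  "christoffel G x u v = (THE z. \<forall>w. 2 * G x z w =
       frechet_derivative (\<lambda>y. G y v w) (at x) u
     + frechet_derivative (\<lambda>y. G y u w) (at x) v
     - frechet_derivative (\<lambda>y. G y u v) (at x) w)"

text \<open>\<open>R(u,v)w = \<nabla>\<^sub>u\<nabla>\<^sub>v w - \<nabla>\<^sub>v\<nabla>\<^sub>u w - \<nabla>\<^bsub>[u,v]\<^esub> w\<close> on coordinate-constant fields.\<close>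

definition riemann :: "'e::euclidean_space local_metric \<Rightarrow> 'e \<Rightarrow> 'e \<Rightarrow> 'e \<Rightarrow> 'e \<Rightarrow> 'e" where
  "riemann G x u v w =
     (frechet_derivative (\<lambda>y. christoffel G y v w) (at x) u
        + christoffel G x u (christoffel G x v w))
   - (frechet_derivative (\<lambda>y. christoffel G y u w) (at x) v
        + christoffel G x v (christoffel G x u w))"

definition sectional :: "'e::euclidean_space local_metric \<Rightarrow> 'e \<Rightarrow> 'e \<Rightarrow> 'e \<Rightarrow> real" where
  "sectional G x u v =
     G x (riemann G x u v v) u / (G x u u * G x v v - (G x u v)\<^sup>2)"

text \<open>The trace of the endomorphism \<open>w \<mapsto> R(w,u)v\<close>; as a trace, it may be computed in any basis.\<close>

definition ricci :: "'e::euclidean_space local_metric \<Rightarrow> 'e \<Rightarrow> 'e \<Rightarrow> 'e \<Rightarrow> real" where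
  "ricci G x u v = (\<Sum>b\<in>Basis. riemann G x b u v \<bullet> b)"

definition orthonormal_frame ::
    "('e::euclidean_space \<Rightarrow> 'e \<Rightarrow> real) \<Rightarrow> 'e set \<Rightarrow> (nat \<Rightarrow> 'e) \<Rightarrow> bool" where
  "orthonormal_frame b L e \<longleftrightarrow>
     span (e ` {..<dim L}) = L \<and>
     (\<forall>i<dim L. \<forall>j<dim L. b (e i) (e j) = (if i = j then 1 else 0))"

text \<open>The quantities defined below by a choice of orthonormal frames do not depend on the choice.\<close>

definition some_frame ::
    "('e::euclidean_space \<Rightarrow> 'e \<Rightarrow> real) \<Rightarrow> 'e set \<Rightarrow> nat \<Rightarrow> 'e" where
  "some_frame b L = (SOME e. orthonormal_frame b L e)"

definition scalar_curvature :: "'e::euclidean_space local_metric \<Rightarrow> 'e \<Rightarrow> real" where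
  "scalar_curvature G x =
     (let e = some_frame (G x) UNIV
      in \<Sum>j<DIM('e). \<Sum>i<j. sectional G x (e i) (e j))"

definition normalized_scalar_curvature :: "'e::euclidean_space local_metric \<Rightarrow> 'e \<Rightarrow> real" where
  "normalized_scalar_curvature G x =
     2 * scalar_curvature G x / (real DIM('e) * (real DIM('e) - 1))"

section \<open>Extrinsic geometry of an isometric immersion in coordinates\<close>

text \<open>In this section \<open>F\<close> is the coordinate expression of the immersion, \<open>G\<close> the metric of the
  submanifold and \<open>H\<close> the metric of the ambient manifold. The second fundamental form is given
  by the Gauss formula: the ambient covariant derivative along \<open>F\<close> of the field \<open>dF(v)\<close> minus
  the image of the intrinsic one.\<close>

definition second_ff ::
    "('e::euclidean_space \<Rightarrow> 'f::euclidean_space) \<Rightarrow> 'e local_metric \<Rightarrow> 'f local_metric \<Rightarrow>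
     'e \<Rightarrow> 'e \<Rightarrow> 'e \<Rightarrow> 'f" where
  "second_ff F G H x u v =
     (frechet_derivative (\<lambda>y. frechet_derivative F (at y) v) (at x) u
        + christoffel H (F x) (frechet_derivative F (at x) u) (frechet_derivative F (at x) v))
   - frechet_derivative F (at x) (christoffel G x u v)"

definition normal_space ::
    "('e::euclidean_space \<Rightarrow> 'f::euclidean_space) \<Rightarrow> 'f local_metric \<Rightarrow> 'e \<Rightarrow> 'f set" where
  "normal_space F H x = {\<xi>. \<forall>u. H (F x) (frechet_derivative F (at x) u) \<xi> = 0}"

definition casorati_on ::
    "('e::euclidean_space \<Rightarrow> 'f::euclidean_space) \<Rightarrow> 'e local_metric \<Rightarrow> 'f local_metric \<Rightarrow>
     'e \<Rightarrow> 'e set \<Rightarrow> real" where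
  "casorati_on F G H x L =
     (let e = some_frame (G x) L;
          \<nu> = some_frame (H (F x)) (normal_space F H x)
      in 1 / real (dim L) *
         (\<Sum>r<dim (normal_space F H x). \<Sum>i<dim L. \<Sum>j<dim L.
            (H (F x) (second_ff F G H x (e i) (e j)) (\<nu> r))\<^sup>2))"

definition casorati ::
    "('e::euclidean_space \<Rightarrow> 'f::euclidean_space) \<Rightarrow> 'e local_metric \<Rightarrow> 'f local_metric \<Rightarrow>
     'e \<Rightarrow> real" where
  "casorati F G H x = casorati_on F G H x UNIV"

definition hyperplanes :: "'e::euclidean_space set set" where
  "hyperplanes = {L. subspace L \<and> dim L = DIM('e) - 1}"

definition delta_casorati_hat ::
    "('e::euclidean_space \<Rightarrow> 'f::euclidean_space) \<Rightarrow> 'e local_metric \<Rightarrow> 'f local_metric \<Rightarrow>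
     'e \<Rightarrow> real" where
  "delta_casorati_hat F G H x =
     2 * casorati F G H x
     - (2 * real DIM('e) - 1) / (2 * real DIM('e)) * (SUP L\<in>hyperplanes. casorati_on F G H x L)"

definition delta_casorati ::
    "('e::euclidean_space \<Rightarrow> 'f::euclidean_space) \<Rightarrow> 'e local_metric \<Rightarrow> 'f local_metric \<Rightarrow>
     'e \<Rightarrow> real" where
  "delta_casorati F G H x =
     1 / 2 * casorati F G H x
     + (real DIM('e) + 1) / (2 * real DIM('e)) * (INF L\<in>hyperplanes. casorati_on F G H x L)"

section \<open>Riemannian manifolds and submanifolds\<close>

text \<open>A Riemannian metric on a manifold is the family of its coordinate expressions, related by
  the tensorial transformation law.\<close>

type_synonym ('a, 'e) metric = "('a, 'e) chart \<Rightarrow> 'e local_metric"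

definition riemannian_manifold ::
    "('a::{t2_space,second_countable_topology}, 'e::euclidean_space) chart set \<Rightarrow>
     ('a, 'e) metric \<Rightarrow> bool" where
  "riemannian_manifold A g \<longleftrightarrow> smooth_atlas A \<and>
     (\<forall>\<kappa>\<in>A. \<forall>x\<in>snd \<kappa> ` fst \<kappa>. inner_product_form (g \<kappa> x)) \<and>
     (\<forall>\<kappa>\<in>A. \<forall>u v. smooth_on (snd \<kappa> ` fst \<kappa>) (\<lambda>x. g \<kappa> x u v)) \<and>
     (\<forall>\<kappa>\<in>A. \<forall>\<kappa>'\<in>A. \<forall>x\<in>rep_domain \<kappa> \<kappa>' id. \<forall>u v.
        g \<kappa> x u v = g \<kappa>' (chart_rep \<kappa> \<kappa>' id x)
          (frechet_derivative (chart_rep \<kappa> \<kappa>' id) (at x) u)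
          (frechet_derivative (chart_rep \<kappa> \<kappa>' id) (at x) v))"

definition real_space_form ::
    "('a::{t2_space,second_countable_topology}, 'e::euclidean_space) chart set \<Rightarrow>
     ('a, 'e) metric \<Rightarrow> real \<Rightarrow> bool" where
  "real_space_form A g c \<longleftrightarrow> riemannian_manifold A g \<and>
     (\<forall>\<kappa>\<in>A. \<forall>x\<in>snd \<kappa> ` fst \<kappa>. \<forall>u v.
        u \<noteq> v \<and> independent {u, v} \<longrightarrow> sectional (g \<kappa>) x u v = c)"

definition einstein_manifold :: "('a, 'e::euclidean_space) chart set \<Rightarrow> ('a, 'e) metric \<Rightarrow> bool" where
  "einstein_manifold A g \<longleftrightarrow>
     (\<exists>\<mu>. \<forall>\<kappa>\<in>A. \<forall>x\<in>snd \<kappa> ` fst \<kappa>. \<forall>u v. ricci (g \<kappa>) x u v = \<mu> * g \<kappa> x u v)"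

text \<open>A Riemannian submanifold is an isometric immersion \<open>f\<close> into the ambient manifold; embedded
  submanifolds are the case of an inclusion. That the differential is injective follows from
  the positivity of \<open>g\<close>.\<close>

definition riemannian_submanifold ::
    "('a::{t2_space,second_countable_topology}, 'e::euclidean_space) chart set \<Rightarrow>
     ('a, 'e) metric \<Rightarrow>
     ('b::{t2_space,second_countable_topology}, 'f::euclidean_space) chart set \<Rightarrow>
     ('b, 'f) metric \<Rightarrow> ('a \<Rightarrow> 'b) \<Rightarrow> bool" where
  "riemannian_submanifold A g B gN f \<longleftrightarrow>
     riemannian_manifold A g \<and> riemannian_manifold B gN \<and> smooth_map A B f \<and>
     (\<forall>\<kappa>\<in>A. \<forall>\<kappa>'\<in>B. \<forall>x\<in>rep_domain \<kappa> \<kappa>' f. \<forall>u v.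
        g \<kappa> x u v = gN \<kappa>' (chart_rep \<kappa> \<kappa>' f x)
          (frechet_derivative (chart_rep \<kappa> \<kappa>' f) (at x) u)
          (frechet_derivative (chart_rep \<kappa> \<kappa>' f) (at x) v))"

text \<open>The conditions below concern tensors and scalars, which do not depend on the charts; they
  are required in all charts around a point and around its image.\<close>

definition totally_geodesic ::
    "('a, 'e::euclidean_space) chart set \<Rightarrow> ('a, 'e) metric \<Rightarrow>
     ('b, 'f::euclidean_space) chart set \<Rightarrow> ('b, 'f) metric \<Rightarrow> ('a \<Rightarrow> 'b) \<Rightarrow> bool" where
  "totally_geodesic A g B gN f \<longleftrightarrow>
     (\<forall>\<kappa>\<in>A. \<forall>\<kappa>'\<in>B. \<forall>x\<in>rep_domain \<kappa> \<kappa>' f. \<forall>u v.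
        second_ff (chart_rep \<kappa> \<kappa>' f) (g \<kappa>) (gN \<kappa>') x u v = 0)"

definition casorati_ideal_hat ::
    "('a, 'e::euclidean_space) chart set \<Rightarrow> ('a, 'e) metric \<Rightarrow>
     ('b, 'f::euclidean_space) chart set \<Rightarrow> ('b, 'f) metric \<Rightarrow> ('a \<Rightarrow> 'b) \<Rightarrow> real \<Rightarrow> bool" where
  "casorati_ideal_hat A g B gN f c \<longleftrightarrow>
     (\<forall>\<kappa>\<in>A. \<forall>\<kappa>'\<in>B. \<forall>x\<in>rep_domain \<kappa> \<kappa>' f.
        normalized_scalar_curvature (g \<kappa>) x =
          delta_casorati_hat (chart_rep \<kappa> \<kappa>' f) (g \<kappa>) (gN \<kappa>') x + c)"

definition casorati_ideal ::
    "('a, 'e::euclidean_space) chart set \<Rightarrow> ('a, 'e) metric \<Rightarrow>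
     ('b, 'f::euclidean_space) chart set \<Rightarrow> ('b, 'f) metric \<Rightarrow> ('a \<Rightarrow> 'b) \<Rightarrow> real \<Rightarrow> bool" where
  "casorati_ideal A g B gN f c \<longleftrightarrow>
     (\<forall>\<kappa>\<in>A. \<forall>\<kappa>'\<in>B. \<forall>x\<in>rep_domain \<kappa> \<kappa>' f.
        normalized_scalar_curvature (g \<kappa>) x =
          delta_casorati (chart_rep \<kappa> \<kappa>' f) (g \<kappa>) (gN \<kappa>') x + c)"

end

(* Fix a point, an orthonormal frame e_1, ..., e_n of the tangent space whose last vector is a unit
   normal of the hyperplane at which the supremum (or infimum) of C(L) is attained, and an orthonormal
   normal frame. By the Gauss equation, n(n-1)(rho - c) is the sum over the normal directions of
   (tr h^r)^2 - |h^r|^2, so n(n-1) times the difference of the two sides of either inequality is a sum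
   of nonnegative quadratic expressions in the h^r, each of them Cauchy-Schwarz for the trace plus
   squares of off-diagonal entries. Equality forces h^r = diag(2s, ..., 2s, s), respectively
   h^r = diag(s, ..., s, 2s). The Ricci curvatures of e_1 and e_n then differ by a nonzero multiple,
   proportional to n - 2, of the sum of the s^2, so the Einstein condition gives h = 0. Conversely, by
   the Gauss equation a totally geodesic submanifold has constant curvature. *)

theory Submission
  imports Defs
begin

section \<open>Directional derivatives of smooth maps\<close>

text \<open>Curvature involves derivatives of Christoffel symbols, which are given only implicitly
  by Koszul's formula; their differentiability must be extracted from that of the metric. Curvature
  identities are then expressed through the scalar function \<open>koszul\<close>, explicit in the
  metric. The Gauss equation comes from differentiating this one function both intrinsically and
  along the immersion, so no normal field is ever differentiated. Hyperplanes carry no topology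
  here; the extremum is found on the compact unit sphere of their normals. Origin of the constants:
  put m = n - 1 and, for one normal direction, let t be the trace of h^r, S its squared norm and S_L
  that of its restriction to L. The two gaps are (2m+1)(S - S_L/2) - t^2 and (m+2)/2 (S + S_L) -
  t^2. The numbers 2m+1 and m+2 are the sharp Cauchy-Schwarz constants for the diagonal weights
  (1/2,...,1/2,1) and (1,...,1,1/2). This sharpness is why equality determines h^r up to one scalar
  s.\<close>

lemma Ck_on_subset: "Ck_on k S F \<Longrightarrow> T \<subseteq> S \<Longrightarrow> Ck_on k T F"
  by (induction k arbitrary: F) (auto intro: continuous_on_subset)

lemma smooth_on_subset: "smooth_on S F \<Longrightarrow> T \<subseteq> S \<Longrightarrow> smooth_on T F"
  using Ck_on_subset unfolding smooth_on_def by blast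

lemma smooth_on_imp_differentiable: "smooth_on S F \<Longrightarrow> x \<in> S \<Longrightarrow> F differentiable (at x)"
  unfolding smooth_on_def by (metis Ck_on.simps(2))

lemma smooth_on_imp_has_derivative:
  "smooth_on S F \<Longrightarrow> x \<in> S \<Longrightarrow> (F has_derivative frechet_derivative F (at x)) (at x)"
  using smooth_on_imp_differentiable frechet_derivative_works by blast

lemma smooth_on_imp_continuous_on: "smooth_on S F \<Longrightarrow> continuous_on S F"
  unfolding smooth_on_def by (metis Ck_on.simps(1))

lemma smooth_on_frechet_derivative:
  "smooth_on S F \<Longrightarrow> smooth_on S (\<lambda>x. frechet_derivative F (at x) v)"
  unfolding smooth_on_def by (metis Ck_on.simps(2))

text \<open>\<open>frechet_derivative\<close> is a choice among all derivatives, so it depends only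
  on the predicate \<open>has_derivative\<close>, which is local. Differentiability therefore plays
  no part in the argument.\<close>

lemma frechet_derivative_cong_open:
  assumes "open S" "x \<in> S" "\<And>y. y \<in> S \<Longrightarrow> f y = g y"
  shows "frechet_derivative f (at x) = frechet_derivative g (at x)"
proof -
  have "(f has_derivative D) (at x) \<longleftrightarrow> (g has_derivative D) (at x)" for D
    using assms has_derivative_transform_within_open[of f D x UNIV S g]
      has_derivative_transform_within_open[of g D x UNIV S f] by auto
  then show ?thesis unfolding frechet_derivative_def by presburger
qed

section \<open>Symmetry of second derivatives\<close>

lemma directional_mvt:
  fixes \<phi> :: "'e::euclidean_space \<Rightarrow> real"
  assumes t: "0 < t"
    and d: "\<And>s. 0 \<le> s \<Longrightarrow> s \<le> t \<Longrightarrow> \<phi> differentiable (at (p + s *\<^sub>R w))"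
  obtains s where "0 < s" "s < t"
    "\<phi> (p + t *\<^sub>R w) - \<phi> p = t * frechet_derivative \<phi> (at (p + s *\<^sub>R w)) w"
proof -
  have der: "((\<lambda>s. \<phi> (p + s *\<^sub>R w)) has_real_derivative
      frechet_derivative \<phi> (at (p + s *\<^sub>R w)) w) (at s)" if "0 \<le> s" "s \<le> t" for s
  proof -
    have 1: "((\<lambda>s. p + s *\<^sub>R w) has_derivative (\<lambda>h. h *\<^sub>R w)) (at s)"
      by (auto intro!: derivative_eq_intros)
    have 2: "(\<phi> has_derivative frechet_derivative \<phi> (at (p + s *\<^sub>R w))) (at (p + s *\<^sub>R w))"
      using d[OF that] frechet_derivative_works by blast
    have "((\<lambda>s. \<phi> (p + s *\<^sub>R w)) has_derivative
        (\<lambda>h. frechet_derivative \<phi> (at (p + s *\<^sub>R w)) (h *\<^sub>R w))) (at s)"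
      using diff_chain_at[OF 1 2] by (simp add: o_def)
    moreover have "frechet_derivative \<phi> (at (p + s *\<^sub>R w)) (h *\<^sub>R w)
        = frechet_derivative \<phi> (at (p + s *\<^sub>R w)) w * h" for h
      using linear_frechet_derivative[OF d[OF that]] by (simp add: linear_scale mult.commute)
    ultimately show ?thesis unfolding has_field_derivative_def by simp
  qed
  have "\<exists>s. 0 < s \<and> s < t \<and> \<phi> (p + t *\<^sub>R w) - \<phi> (p + 0 *\<^sub>R w)
      = (t - 0) * frechet_derivative \<phi> (at (p + s *\<^sub>R w)) w"
    by (rule MVT2[OF t der])
  then show ?thesis using that by auto
qed

text \<open>Two mean value steps: one in direction \<open>u\<close> for the difference of
  \<open>\<phi>\<close> across \<open>t *\<^sub>R v\<close>, then one in direction \<open>v\<close>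
  for the \<open>u\<close>-derivative of \<open>\<phi>\<close>.\<close>

lemma second_difference_mvt:
  fixes \<phi> :: "'e::euclidean_space \<Rightarrow> real"
  assumes sm: "smooth_on S \<phi>" and t: "0 < t"
    and sub: "\<And>a b. 0 \<le> a \<Longrightarrow> a \<le> t \<Longrightarrow> 0 \<le> b \<Longrightarrow> b \<le> t \<Longrightarrow> x + a *\<^sub>R u + b *\<^sub>R v \<in> S"
  obtains a b where "0 < a" "a < t" "0 < b" "b < t"
    "\<phi> (x + t *\<^sub>R u + t *\<^sub>R v) - \<phi> (x + t *\<^sub>R u) - \<phi> (x + t *\<^sub>R v) + \<phi> x =
      t\<^sup>2 * frechet_derivative (\<lambda>y. frechet_derivative \<phi> (at y) u) (at (x + a *\<^sub>R u + b *\<^sub>R v)) v"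
proof -
  have dv: "\<phi> differentiable (at y)" if "y \<in> S" for y
    using sm that smooth_on_imp_differentiable by blast
  have sh: "(\<lambda>z. \<phi> (z + t *\<^sub>R v)) differentiable (at y) \<and>
      frechet_derivative (\<lambda>z. \<phi> (z + t *\<^sub>R v)) (at y) = frechet_derivative \<phi> (at (y + t *\<^sub>R v))"
    if "y + t *\<^sub>R v \<in> S" for y
  proof -
    have "((\<lambda>z. z + t *\<^sub>R v) has_derivative (\<lambda>h. h)) (at y)" by (auto intro!: derivative_eq_intros)
    from diff_chain_at[OF this smooth_on_imp_has_derivative[OF sm that]]
    have *: "((\<lambda>z. \<phi> (z + t *\<^sub>R v)) has_derivative frechet_derivative \<phi> (at (y + t *\<^sub>R v))) (at y)"
      by (simp add: o_def)
    then show ?thesis using frechet_derivative_at[OF *] differentiableI by auto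
  qed
  define \<psi> where "\<psi> = (\<lambda>z. \<phi> (z + t *\<^sub>R v) - \<phi> z)"
  have dpsi: "(\<psi> has_derivative (\<lambda>h. frechet_derivative \<phi> (at (y + t *\<^sub>R v)) h - frechet_derivative \<phi> (at y) h)) (at y)"
    if "y + t *\<^sub>R v \<in> S" "y \<in> S" for y
    unfolding \<psi>_def
    using has_derivative_diff[OF _ smooth_on_imp_has_derivative[OF sm that(2)]]
      sh[OF that(1)] frechet_derivative_works[of "\<lambda>z. \<phi> (z + t *\<^sub>R v)" "at y"] by metis
  have inS: "x + a *\<^sub>R u + t *\<^sub>R v \<in> S" "x + a *\<^sub>R u \<in> S" if "0 \<le> a" "a \<le> t" for a
    using sub[OF that, of t] sub[OF that, of 0] t by auto
  obtain a where a: "0 < a" "a < t" "\<psi> (x + t *\<^sub>R u) - \<psi> x = t * frechet_derivative \<psi> (at (x + a *\<^sub>R u)) u"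
    using directional_mvt[OF t, of \<psi> x u] dpsi inS differentiableI by metis
  have e: "frechet_derivative \<psi> (at (x + a *\<^sub>R u)) u
      = frechet_derivative \<phi> (at (x + a *\<^sub>R u + t *\<^sub>R v)) u - frechet_derivative \<phi> (at (x + a *\<^sub>R u)) u"
    using fun_cong[OF frechet_derivative_at[OF dpsi[OF inS[of a]]], of u] a by simp
  have dd: "(\<lambda>y. frechet_derivative \<phi> (at y) u) differentiable (at (x + a *\<^sub>R u + b *\<^sub>R v))"
    if "0 \<le> b" "b \<le> t" for b
    using smooth_on_imp_differentiable[OF smooth_on_frechet_derivative[OF sm]] sub[of a b] a that by auto
  obtain b where b: "0 < b" "b < t" "frechet_derivative \<phi> (at (x + a *\<^sub>R u + t *\<^sub>R v)) u
      - frechet_derivative \<phi> (at (x + a *\<^sub>R u)) u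
      = t * frechet_derivative (\<lambda>y. frechet_derivative \<phi> (at y) u) (at (x + a *\<^sub>R u + b *\<^sub>R v)) v"
    using directional_mvt[OF t, of "\<lambda>y. frechet_derivative \<phi> (at y) u" "x + a *\<^sub>R u" v] dd by metis
  have "\<phi> (x + t *\<^sub>R u + t *\<^sub>R v) - \<phi> (x + t *\<^sub>R u) - \<phi> (x + t *\<^sub>R v) + \<phi> x = \<psi> (x + t *\<^sub>R u) - \<psi> x"
    unfolding \<psi>_def by simp
  also have "\<dots> = t\<^sup>2 * frechet_derivative (\<lambda>y. frechet_derivative \<phi> (at y) u) (at (x + a *\<^sub>R u + b *\<^sub>R v)) v"
    using a(3) e b(3) by (simp add: power2_eq_square)
  finally show ?thesis using that a(1,2) b(1,2) by blast
qed

text \<open>The mean value point lies in a parallelogram shrinking to \<open>x\<close>, and the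
  mixed derivative is continuous there. The quotient is symmetric in \<open>u\<close> and
  \<open>v\<close>, which is what makes the limit useful.\<close>

lemma second_difference_limit:
  fixes \<phi> :: "'e::euclidean_space \<Rightarrow> real"
  assumes sm: "smooth_on S \<phi>" and S: "open S" "x \<in> S"
  shows "((\<lambda>t. (\<phi> (x + t *\<^sub>R u + t *\<^sub>R v) - \<phi> (x + t *\<^sub>R u) - \<phi> (x + t *\<^sub>R v) + \<phi> x) / t\<^sup>2)
    \<longlongrightarrow> frechet_derivative (\<lambda>y. frechet_derivative \<phi> (at y) u) (at x) v) (at_right 0)"
proof (rule tendstoI)
  fix e :: real assume e: "e > 0"
  define \<theta> where "\<theta> = (\<lambda>y. frechet_derivative (\<lambda>y. frechet_derivative \<phi> (at y) u) (at y) v)"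
  have "continuous_on S \<theta>"
    unfolding \<theta>_def by (intro smooth_on_imp_continuous_on smooth_on_frechet_derivative sm)
  then have "isCont \<theta> x" using S continuous_on_eq_continuous_at by blast
  then obtain d1 where d1: "d1 > 0" "\<And>y. dist y x < d1 \<Longrightarrow> dist (\<theta> y) (\<theta> x) < e"
    using e unfolding continuous_at_eps_delta by blast
  obtain d2 where d2: "d2 > 0" "ball x d2 \<subseteq> S" using S open_contains_ball by blast
  define d where "d = min d1 d2"
  \<comment> \<open>The parallelogram with sides \<open>t *\<^sub>R u\<close> and
    \<open>t *\<^sub>R v\<close> lies within distance \<open>t * K\<close> of \<open>x\<close>; the
    summand 1 keeps \<open>K\<close> positive when both vectors vanish.\<close>
  define K where "K = norm u + norm v + 1"
  have K: "K > 0" unfolding K_def by (simp add: add_nonneg_pos)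
  have near: "dist (x + a *\<^sub>R u + b *\<^sub>R v) x < d" if "0 \<le> a" "a \<le> t" "0 \<le> b" "b \<le> t" "t < d / K" "0 < t" for a b t
  proof -
    have "dist (x + a *\<^sub>R u + b *\<^sub>R v) x = norm (a *\<^sub>R u + b *\<^sub>R v)" by (simp add: dist_norm)
    also have "\<dots> \<le> a * norm u + b * norm v" using norm_triangle_ineq[of "a *\<^sub>R u" "b *\<^sub>R v"] that by simp
    also have "\<dots> \<le> t * norm u + t * norm v" using that by (intro add_mono mult_right_mono) auto
    also have "\<dots> < t * K" unfolding K_def using that by (simp add: algebra_simps)
    also have "\<dots> < d" using that K by (simp add: field_simps)
    finally show ?thesis .
  qed
  have "\<forall>\<^sub>F t in at_right 0. t < d / K" "\<forall>\<^sub>F t in at_right (0::real). 0 < t"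
    using d1 d2 K unfolding d_def by (auto intro!: eventually_at_right_less order_tendstoD(2)[OF tendsto_ident_at])
  then show "\<forall>\<^sub>F t in at_right 0. dist ((\<phi> (x + t *\<^sub>R u + t *\<^sub>R v) - \<phi> (x + t *\<^sub>R u) - \<phi> (x + t *\<^sub>R v) + \<phi> x) / t\<^sup>2)
      (frechet_derivative (\<lambda>y. frechet_derivative \<phi> (at y) u) (at x) v) < e"
  proof eventually_elim
    case (elim t)
    have "x + a *\<^sub>R u + b *\<^sub>R v \<in> S" if "0 \<le> a" "a \<le> t" "0 \<le> b" "b \<le> t" for a b
      using near[OF that elim] d2 unfolding d_def by (auto simp: dist_commute)
    then obtain a b where ab: "0 < a" "a < t" "0 < b" "b < t"
      "\<phi> (x + t *\<^sub>R u + t *\<^sub>R v) - \<phi> (x + t *\<^sub>R u) - \<phi> (x + t *\<^sub>R v) + \<phi> x = t\<^sup>2 * \<theta> (x + a *\<^sub>R u + b *\<^sub>R v)"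
      using second_difference_mvt[OF sm elim(2), of x u v] unfolding \<theta>_def by blast
    have "dist (x + a *\<^sub>R u + b *\<^sub>R v) x < d1"
      using near[of a t b] ab elim unfolding d_def by auto
    then have "dist (\<theta> (x + a *\<^sub>R u + b *\<^sub>R v)) (\<theta> x) < e" using d1 by blast
    then show ?case using ab(5) elim(2) unfolding \<theta>_def by simp
  qed
qed

lemma frechet_derivative_inner_left:
  assumes "F differentiable (at x)"
  shows "frechet_derivative (\<lambda>y. F y \<bullet> b) (at x) = (\<lambda>u. frechet_derivative F (at x) u \<bullet> b)"
  using has_derivative_inner_left[OF assms[unfolded frechet_derivative_works]] frechet_derivative_at by metis

lemma Ck_on_cong:
  assumes "open S" "\<And>y. y \<in> S \<Longrightarrow> f y = g y"
  shows "Ck_on k S f \<longleftrightarrow> Ck_on k S g"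
  using assms(2)
proof (induction k arbitrary: f g)
  case 0
  then show ?case by (simp cong: continuous_on_cong)
next
  case (Suc k)
  have "f differentiable (at x) \<longleftrightarrow> g differentiable (at x)" if "x \<in> S" for x
    using Suc.prems assms(1) that has_derivative_transform_within_open[of f _ x UNIV S g]
      has_derivative_transform_within_open[of g _ x UNIV S f]
    unfolding differentiable_def by metis
  moreover have "Ck_on k S (\<lambda>x. frechet_derivative f (at x) v) \<longleftrightarrow>
      Ck_on k S (\<lambda>x. frechet_derivative g (at x) v)" for v
    using Suc.IH frechet_derivative_cong_open[OF assms(1) _ Suc.prems] by presburger
  ultimately show ?case by simp
qed

lemma Ck_on_inner_left:
  assumes "open S" "Ck_on k S F"
  shows "Ck_on k S (\<lambda>x. F x \<bullet> b)"
  using assms(2)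
proof (induction k arbitrary: F)
  case 0
  then show ?case by (simp add: continuous_on_inner)
next
  case (Suc k)
  then have d: "F differentiable (at x)" if "x \<in> S" for x using that by simp
  have "Ck_on k S (\<lambda>x. frechet_derivative (\<lambda>y. F y \<bullet> b) (at x) v) \<longleftrightarrow>
      Ck_on k S (\<lambda>x. frechet_derivative F (at x) v \<bullet> b)" for v
    by (rule Ck_on_cong[OF assms(1)]) (simp add: frechet_derivative_inner_left[OF d])
  moreover have "(\<lambda>x. F x \<bullet> b) differentiable (at x)" if "x \<in> S" for x
    using d[OF that] by (simp add: differentiable_inner)
  ultimately show ?case using Suc by auto
qed

lemma smooth_on_inner_left: "open S \<Longrightarrow> smooth_on S F \<Longrightarrow> smooth_on S (\<lambda>x. F x \<bullet> b)"
  unfolding smooth_on_def using Ck_on_inner_left by blast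

text \<open>The mean value theorem is a statement about real functions, so the claim is tested
  against each basis vector \<open>b\<close>. For the component both mixed derivatives are limits of
  the same second difference quotient.\<close>

theorem second_derivative_symmetric:
  fixes F :: "'e::euclidean_space \<Rightarrow> 'f::euclidean_space"
  assumes sm: "smooth_on S F" and S: "open S" "x \<in> S"
  shows "frechet_derivative (\<lambda>y. frechet_derivative F (at y) u) (at x) v =
    frechet_derivative (\<lambda>y. frechet_derivative F (at y) v) (at x) u"
proof (rule euclidean_eqI)
  fix b :: 'f
  have real: "frechet_derivative (\<lambda>y. frechet_derivative F (at y) u) (at x) v \<bullet> b =
    frechet_derivative (\<lambda>y. frechet_derivative (\<lambda>z. F z \<bullet> b) (at y) u) (at x) v" for u v
  proof -
    have "frechet_derivative (\<lambda>y. frechet_derivative F (at y) u) (at x) v \<bullet> b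
        = frechet_derivative (\<lambda>y. frechet_derivative F (at y) u \<bullet> b) (at x) v"
      using frechet_derivative_inner_left[of "\<lambda>y. frechet_derivative F (at y) u" x b]
        smooth_on_imp_differentiable[OF smooth_on_frechet_derivative[OF sm] S(2)] by simp
    also have "\<dots> = frechet_derivative (\<lambda>y. frechet_derivative (\<lambda>z. F z \<bullet> b) (at y) u) (at x) v"
      by (rule fun_cong[OF frechet_derivative_cong_open[OF S]])
        (simp add: frechet_derivative_inner_left[OF smooth_on_imp_differentiable[OF sm]])
    finally show ?thesis .
  qed
  define \<phi> where "\<phi> = (\<lambda>z. F z \<bullet> b)"
  have sp: "smooth_on S \<phi>" unfolding \<phi>_def by (rule smooth_on_inner_left[OF S(1) sm])
  have "frechet_derivative (\<lambda>y. frechet_derivative \<phi> (at y) u) (at x) v =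
    frechet_derivative (\<lambda>y. frechet_derivative \<phi> (at y) v) (at x) u"
    using second_difference_limit[OF sp S, of u v] second_difference_limit[OF sp S, of v u]
    by (intro tendsto_unique[OF trivial_limit_at_right_real]) (auto simp: algebra_simps)
  then show "frechet_derivative (\<lambda>y. frechet_derivative F (at y) u) (at x) v \<bullet> b =
    frechet_derivative (\<lambda>y. frechet_derivative F (at y) v) (at x) u \<bullet> b"
    unfolding real \<phi>_def .
qed

section \<open>Bilinear forms depending on a point\<close>

lemma bilinear_expand:
  assumes "bilinear h"
  shows "h v w = (\<Sum>i\<in>Basis. \<Sum>j\<in>Basis. ((v \<bullet> i) * (w \<bullet> j)) *\<^sub>R h i j)"
proof -
  have "h v w = h (\<Sum>i\<in>Basis. (v \<bullet> i) *\<^sub>R i) (\<Sum>j\<in>Basis. (w \<bullet> j) *\<^sub>R j)"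
    by (simp add: euclidean_representation)
  also have "\<dots> = (\<Sum>i\<in>Basis. \<Sum>j\<in>Basis. ((v \<bullet> i) * (w \<bullet> j)) *\<^sub>R h i j)"
    unfolding bilinear_sum[OF assms] sum.cartesian_product[symmetric]
    by (simp add: bilinear_lmul[OF assms] bilinear_rmul[OF assms] mult.commute)
  finally show ?thesis .
qed

text \<open>A Leibniz rule with three factors, where \<open>B\<close> is known to be differentiable
  only on constant arguments. In finite dimension this suffices: expanded in the basis, the
  expression is a finite sum of products of differentiable functions.\<close>

lemma has_derivative_bilinear_field:
  fixes B :: "'e::real_normed_vector \<Rightarrow> 'a::euclidean_space \<Rightarrow> 'b::euclidean_space \<Rightarrow> 'c::real_normed_vector"
  assumes U: "open U" "x \<in> U" and bil: "\<And>y. y \<in> U \<Longrightarrow> bilinear (B y)"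
    and dB: "\<And>v w. (\<lambda>y. B y v w) differentiable (at x)"
    and a: "(a has_derivative a') (at x)" and b: "(b has_derivative b') (at x)"
  shows "((\<lambda>y. B y (a y) (b y)) has_derivative (\<lambda>u. frechet_derivative (\<lambda>y. B y (a x) (b x)) (at x) u
    + B x (a' u) (b x) + B x (a x) (b' u))) (at x)"
proof -
  have dBij: "((\<lambda>y. B y v w) has_derivative frechet_derivative (\<lambda>y. B y v w) (at x)) (at x)" for v w
    using dB frechet_derivative_works by blast
  let ?E = "\<lambda>u. (\<Sum>i\<in>Basis. \<Sum>j\<in>Basis. ((a x \<bullet> i) * (b x \<bullet> j)) *\<^sub>R frechet_derivative (\<lambda>y. B y i j) (at x) u
        + ((a' u \<bullet> i) * (b x \<bullet> j) + (a x \<bullet> i) * (b' u \<bullet> j)) *\<^sub>R B x i j)"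
  have "((\<lambda>y. \<Sum>i\<in>Basis. \<Sum>j\<in>Basis. ((a y \<bullet> i) * (b y \<bullet> j)) *\<^sub>R B y i j) has_derivative ?E) (at x)"
    by (auto intro!: derivative_eq_intros dBij a b simp: algebra_simps)
  then have 1: "((\<lambda>y. B y (a y) (b y)) has_derivative ?E) (at x)"
    by (rule has_derivative_transform_within_open[OF _ U]) (simp add: bilinear_expand[OF bil, symmetric])
  \<comment> \<open>Collects the derivatives of the coefficients \<open>B y i j\<close> into a
    single derivative with both arguments frozen.\<close>
  have 2: "frechet_derivative (\<lambda>y. B y v w) (at x) u
      = (\<Sum>i\<in>Basis. \<Sum>j\<in>Basis. ((v \<bullet> i) * (w \<bullet> j)) *\<^sub>R frechet_derivative (\<lambda>y. B y i j) (at x) u)" for v w u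
  proof -
    have "((\<lambda>y. \<Sum>i\<in>Basis. \<Sum>j\<in>Basis. ((v \<bullet> i) * (w \<bullet> j)) *\<^sub>R B y i j) has_derivative
       (\<lambda>u. (\<Sum>i\<in>Basis. \<Sum>j\<in>Basis. ((v \<bullet> i) * (w \<bullet> j)) *\<^sub>R frechet_derivative (\<lambda>y. B y i j) (at x) u))) (at x)"
      by (auto intro!: derivative_eq_intros dBij)
    then have "((\<lambda>y. B y v w) has_derivative
       (\<lambda>u. (\<Sum>i\<in>Basis. \<Sum>j\<in>Basis. ((v \<bullet> i) * (w \<bullet> j)) *\<^sub>R frechet_derivative (\<lambda>y. B y i j) (at x) u))) (at x)"
      by (rule has_derivative_transform_within_open[OF _ U]) (simp add: bilinear_expand[OF bil, symmetric])
    from fun_cong[OF frechet_derivative_at[OF this]] show ?thesis by simp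
  qed
  have "?E = (\<lambda>u. frechet_derivative (\<lambda>y. B y (a x) (b x)) (at x) u
    + B x (a' u) (b x) + B x (a x) (b' u))"
  proof
    fix u
    show "?E u = frechet_derivative (\<lambda>y. B y (a x) (b x)) (at x) u + B x (a' u) (b x) + B x (a x) (b' u)"
      unfolding 2[of "a x" "b x"] bilinear_expand[OF bil[OF U(2)], of "a x" "b' u"]
        bilinear_expand[OF bil[OF U(2)], of "a' u" "b x"]
      by (simp only: sum.distrib[symmetric] scaleR_left_distrib add.assoc)
  qed
  then show ?thesis using 1 by simp
qed

lemma frechet_derivative_bilinear_field:
  fixes B :: "'e::real_normed_vector \<Rightarrow> 'a::euclidean_space \<Rightarrow> 'b::euclidean_space \<Rightarrow> 'c::real_normed_vector"
  assumes "open U" "x \<in> U" "\<And>y. y \<in> U \<Longrightarrow> bilinear (B y)"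
    "\<And>v w. (\<lambda>y. B y v w) differentiable (at x)" "a differentiable (at x)" "b differentiable (at x)"
  shows "frechet_derivative (\<lambda>y. B y (a y) (b y)) (at x) u =
    frechet_derivative (\<lambda>y. B y (a x) (b x)) (at x) u
    + B x (frechet_derivative a (at x) u) (b x) + B x (a x) (frechet_derivative b (at x) u)"
  by (rule fun_cong[OF frechet_derivative_at[OF has_derivative_bilinear_field[OF assms(1-4)
    assms(5,6)[unfolded frechet_derivative_works]]], symmetric])

lemma bilinear_frechet_derivative_field:
  fixes B :: "'e::real_normed_vector \<Rightarrow> 'a::euclidean_space \<Rightarrow> 'b::euclidean_space \<Rightarrow> 'c::real_normed_vector"
  assumes U: "open U" "x \<in> U" and bil: "\<And>y. y \<in> U \<Longrightarrow> bilinear (B y)"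
    and dB: "\<And>v w. (\<lambda>y. B y v w) differentiable (at x)"
  shows "bilinear (\<lambda>v w. frechet_derivative (\<lambda>y. B y v w) (at x) u)"
proof -
  have dBij: "((\<lambda>y. B y v w) has_derivative frechet_derivative (\<lambda>y. B y v w) (at x)) (at x)" for v w
    using dB frechet_derivative_works by blast
  have lin: "((\<lambda>y. r *\<^sub>R B y v w + s *\<^sub>R B y v' w') has_derivative (\<lambda>u. r *\<^sub>R frechet_derivative (\<lambda>y. B y v w) (at x) u
       + s *\<^sub>R frechet_derivative (\<lambda>y. B y v' w') (at x) u)) (at x)" for r s v v' w w'
    by (auto intro!: derivative_eq_intros dBij)
  have L: "frechet_derivative (\<lambda>y. B y (r *\<^sub>R v + s *\<^sub>R v') w) (at x) u =
      r *\<^sub>R frechet_derivative (\<lambda>y. B y v w) (at x) u + s *\<^sub>R frechet_derivative (\<lambda>y. B y v' w) (at x) u" for r s v v' w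
    using frechet_derivative_at[OF has_derivative_transform_within_open[OF lin[of r v w s v' w] U, of "\<lambda>y. B y (r *\<^sub>R v + s *\<^sub>R v') w"]]
    by (simp add: bilinear_ladd[OF bil] bilinear_lmul[OF bil] fun_eq_iff)
  have R: "frechet_derivative (\<lambda>y. B y w (r *\<^sub>R v + s *\<^sub>R v')) (at x) u =
      r *\<^sub>R frechet_derivative (\<lambda>y. B y w v) (at x) u + s *\<^sub>R frechet_derivative (\<lambda>y. B y w v') (at x) u" for r s v v' w
    using frechet_derivative_at[OF has_derivative_transform_within_open[OF lin[of r w v s w v'] U, of "\<lambda>y. B y w (r *\<^sub>R v + s *\<^sub>R v')"]]
    by (simp add: bilinear_radd[OF bil] bilinear_rmul[OF bil] fun_eq_iff)
  show ?thesis unfolding bilinear_def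
    using L[of 1 _ 1] L[of _ _ 0] R[of _ 1 _ 1] R[of _ _ _ 0] by (auto intro!: linearI)
qed

section \<open>Inner products and orthonormal frames\<close>

locale ip_form =
  fixes b :: "'e::euclidean_space \<Rightarrow> 'e \<Rightarrow> real"
  assumes inner_product: "inner_product_form b"
begin

lemma sym: "b u v = b v u"
  using inner_product unfolding inner_product_form_def by blast

lemma linear_right: "linear (b u)"
  using inner_product unfolding inner_product_form_def by blast

lemma linear_left: "linear (\<lambda>u. b u v)"
proof -
  have "(\<lambda>u. b u v) = b v" using sym by blast
  then show ?thesis using linear_right[of v] by simp
qed

lemma bilinear: "bilinear b"
  unfolding bilinear_def using linear_right linear_left by blast

lemmas add_left = bilinear_ladd[OF bilinear]
  and add_right = bilinear_radd[OF bilinear]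
  and diff_left = bilinear_lsub[OF bilinear]
  and diff_right = bilinear_rsub[OF bilinear]
  and scale_left = bilinear_lmul[OF bilinear]
  and scale_right = bilinear_rmul[OF bilinear]
  and zero_left = bilinear_lzero[OF bilinear]
  and zero_right = bilinear_rzero[OF bilinear]

lemma sum_left: "b (\<Sum>i\<in>I. f i) v = (\<Sum>i\<in>I. b (f i) v)"
  using linear_sum[OF linear_left[of v]] .

lemma sum_right: "b v (\<Sum>i\<in>I. f i) = (\<Sum>i\<in>I. b v (f i))"
  using linear_sum[OF linear_right[of v]] .

lemma pos: "u \<noteq> 0 \<Longrightarrow> 0 < b u u"
  using inner_product unfolding inner_product_form_def by blast

lemma self_eq_0_iff: "b u u = 0 \<longleftrightarrow> u = 0"
  using pos[of u] zero_left by force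

lemma eq_0_I: "(\<And>w. b z w = 0) \<Longrightarrow> z = 0"
  using self_eq_0_iff by blast

lemma eq_I: "(\<And>w. b z w = b z' w) \<Longrightarrow> z = z'"
  using eq_0_I[of "z - z'"] by (simp add: diff_left)

text \<open>The Gram matrix of \<open>b\<close> acting on \<open>z\<close>: it converts
  \<open>b\<close> into the dot product of the model space, so facts about dot products and linear
  maps carry over to \<open>b\<close>.\<close>

definition gram :: "'e \<Rightarrow> 'e" where
  "gram z = (\<Sum>k\<in>Basis. b z k *\<^sub>R k)"

lemma gram_inner: "gram z \<bullet> w = b z w"
proof -
  have "b z w = b z (\<Sum>k\<in>Basis. (w \<bullet> k) *\<^sub>R k)" by (simp add: euclidean_representation)
  also have "\<dots> = gram z \<bullet> w"
    unfolding gram_def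
    by (simp add: sum_right scale_right inner_sum_right inner_commute[of _ w] mult.commute)
  finally show ?thesis by simp
qed

lemma linear_gram: "linear gram"
  by (rule linearI; rule vector_eq_rdot[THEN iffD1])
    (simp_all add: inner_add_left gram_inner add_left scale_left)

lemma inj_gram: "inj gram"
  unfolding linear_injective_0[OF linear_gram] using gram_inner self_eq_0_iff by (metis inner_zero_left)

lemma bij_gram: "bij gram"
  using linear_injective_imp_surjective[OF linear_gram inj_gram] inj_gram by (simp add: bij_def)

text \<open>A functional is a dot product with some vector, and the bijection \<open>gram\<close>
  turns that vector into a representative for \<open>b\<close>. This justifies the definite
  description in \<open>christoffel\<close>.\<close>

lemma riesz:
  assumes "linear \<phi>"
  shows "\<exists>!z. \<forall>w. b z w = \<phi> w"
proof -
  have "\<phi> w = (\<Sum>k\<in>Basis. \<phi> k *\<^sub>R k) \<bullet> w" for w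
    using linear_sum[OF assms, of "\<lambda>k. (w \<bullet> k) *\<^sub>R k" Basis]
    by (simp add: euclidean_representation linear_scale[OF assms] inner_sum_right inner_commute[of _ w]
        mult.commute)
  moreover obtain z where "gram z = (\<Sum>k\<in>Basis. \<phi> k *\<^sub>R k)" using bij_gram by (metis bij_pointE)
  ultimately have "\<forall>w. b z w = \<phi> w" using gram_inner by metis
  then show ?thesis using eq_I by metis
qed

section \<open>Orthonormal systems and frames\<close>

text \<open>Unlike \<open>orthonormal_frame\<close>, this does not tie the length to a subspace, so
  a system can grow by one vector at a time.\<close>

definition orthonormal :: "nat \<Rightarrow> (nat \<Rightarrow> 'e) \<Rightarrow> bool" where
  "orthonormal m e \<longleftrightarrow> (\<forall>i<m. \<forall>j<m. b (e i) (e j) = (if i = j then 1 else 0))"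

lemma orthogonal_span:
  assumes "\<And>i. i < m \<Longrightarrow> b w (e i) = 0" "v \<in> span (e ` {..<m})"
  shows "b w v = 0"
  using assms(2)
proof (induction rule: span_induct)
  case base
  show ?case unfolding subspace_def by (auto simp: zero_right add_right scale_right)
qed (use assms(1) in auto)

lemma orthonormal_coefficients:
  assumes "orthonormal m e" "j < m"
  shows "(\<Sum>i<m. c i * b (e i) (e j)) = c j" "(\<Sum>i<m. c i * b (e j) (e i)) = c j"
proof -
  have "(\<Sum>i<m. c i * b (e i) (e j)) = (\<Sum>i<m. if i = j then c i else 0)"
    using assms unfolding orthonormal_def by (intro sum.cong) auto
  then show "(\<Sum>i<m. c i * b (e i) (e j)) = c j" using assms by simp
  have "(\<Sum>i<m. c i * b (e j) (e i)) = (\<Sum>i<m. if i = j then c i else 0)"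
    using assms unfolding orthonormal_def by (intro sum.cong) auto
  then show "(\<Sum>i<m. c i * b (e j) (e i)) = c j" using assms by simp
qed

lemma residual_orthogonal:
  assumes "orthonormal m e" "j < m"
  shows "b (v - (\<Sum>i<m. b v (e i) *\<^sub>R e i)) (e j) = 0"
  using orthonormal_coefficients(1)[OF assms, of "\<lambda>i. b v (e i)"] by (simp add: diff_left sum_left scale_left)

lemma orthonormal_expand:
  assumes e: "orthonormal m e" and v: "v \<in> span (e ` {..<m})"
  shows "(\<Sum>i<m. b v (e i) *\<^sub>R e i) = v"
proof -
  let ?w = "v - (\<Sum>i<m. b v (e i) *\<^sub>R e i)"
  have "?w \<in> span (e ` {..<m})"
    by (intro span_diff v span_sum span_scale span_base) auto
  then have "b ?w ?w = 0" using orthogonal_span[of m ?w e] residual_orthogonal[OF e] by blast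
  then show ?thesis by (simp add: self_eq_0_iff)
qed

lemma dim_orthonormal:
  assumes e: "orthonormal m e"
  shows "dim (span (e ` {..<m})) = m"
proof -
  have inj: "inj_on e {..<m}"
    using e unfolding orthonormal_def inj_on_def by (metis lessThan_iff zero_neq_one)
  have "independent (e ` {..<m})"
  proof
    assume "dependent (e ` {..<m})"
    then obtain j where j: "j < m" "e j \<in> span (e ` {..<m} - {e j})"
      unfolding dependent_def by auto
    have "b (e j) v = 0" if "v \<in> span (e ` {..<m} - {e j})" for v
      using that
    proof (induction rule: span_induct)
      case base
      show ?case unfolding subspace_def by (auto simp: zero_right add_right scale_right)
    next
      case (step x)
      then show ?case using e j(1) unfolding orthonormal_def by auto
    qed
    from this[OF j(2)] show False using e j(1) unfolding orthonormal_def by simp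
  qed
  then have "dim (e ` {..<m}) = card (e ` {..<m})" by (rule dim_eq_card_independent)
  then show ?thesis using card_image[OF inj] by simp
qed

text \<open>One Gram-Schmidt step: a vector of \<open>L\<close> outside the span loses its
  projection to the span and is then normalised.\<close>

lemma orthonormal_extend:
  assumes e: "orthonormal m e" and L: "subspace L" "e ` {..<m} \<subseteq> L" "m < dim L"
  obtains v where "v \<in> L" "b v v = 1" "\<And>i. i < m \<Longrightarrow> b v (e i) = 0"
proof -
  have sp: "span (e ` {..<m}) \<subseteq> L" using L span_minimal by blast
  have "span (e ` {..<m}) \<noteq> L" using dim_orthonormal[OF e] L(3) by auto
  then obtain w where w: "w \<in> L" "w \<notin> span (e ` {..<m})" using sp by blast
  define v where "v = w - (\<Sum>i<m. b w (e i) *\<^sub>R e i)"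
  have s: "(\<Sum>i<m. b w (e i) *\<^sub>R e i) \<in> span (e ` {..<m})"
    by (intro span_sum span_scale span_base) auto
  then have v: "v \<in> L" "v \<noteq> 0" unfolding v_def using w sp L(1) by (auto intro: subspace_diff)
  have p: "b v v > 0" using pos v by blast
  show thesis
  proof
    show "(1 / sqrt (b v v)) *\<^sub>R v \<in> L" using v L by (simp add: subspace_scale)
    show "b ((1 / sqrt (b v v)) *\<^sub>R v) ((1 / sqrt (b v v)) *\<^sub>R v) = 1"
      using p by (simp add: scale_left scale_right field_simps)
    show "b ((1 / sqrt (b v v)) *\<^sub>R v) (e i) = 0" if "i < m" for i
      using residual_orthogonal[OF e that, of w] unfolding v_def[symmetric] by (simp add: scale_left)
  qed
qed

lemma orthonormal_upd:
  assumes "orthonormal m e" "b v v = 1" "\<And>i. i < m \<Longrightarrow> b v (e i) = 0"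
  shows "orthonormal (Suc m) (e(m := v))"
  using assms sym unfolding orthonormal_def by (auto simp: less_Suc_eq)

lemma orthonormal_imp_frame:
  assumes e: "orthonormal (dim L) e" and L: "subspace L" "e ` {..<dim L} \<subseteq> L"
  shows "orthonormal_frame b L e"
proof -
  have "span (e ` {..<dim L}) = L"
    using subspace_dim_equal[of "span (e ` {..<dim L})" L] L dim_orthonormal[OF e] span_minimal[OF L(2,1)]
    by simp
  then show ?thesis using e unfolding orthonormal_frame_def orthonormal_def by blast
qed

lemma frame_exists:
  assumes L: "subspace L"
  shows "\<exists>e. orthonormal_frame b L e"
proof -
  have "\<exists>e. orthonormal m e \<and> e ` {..<m} \<subseteq> L" if "m \<le> dim L" for m
    using that
  proof (induction m)
    case 0
    then show ?case by (simp add: orthonormal_def)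
  next
    case (Suc m)
    then obtain e where e: "orthonormal m e" "e ` {..<m} \<subseteq> L" by auto
    then obtain v where v: "v \<in> L" "b v v = 1" "\<And>i. i < m \<Longrightarrow> b v (e i) = 0"
      using orthonormal_extend[OF e(1) L e(2)] Suc.prems by auto
    have "(e(m := v)) ` {..<Suc m} \<subseteq> L" using e(2) v(1) by (auto simp: less_Suc_eq)
    then show ?case using orthonormal_upd[OF e(1) v(2,3)] by blast
  qed
  then show ?thesis using orthonormal_imp_frame[OF _ L] by blast
qed

lemma some_frame: "subspace L \<Longrightarrow> orthonormal_frame b L (some_frame b L)"
  unfolding some_frame_def using frame_exists by (metis someI_ex)

lemma frame_orthonormal: "orthonormal_frame b L e \<Longrightarrow> orthonormal (dim L) e"
  unfolding orthonormal_frame_def orthonormal_def by blast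

lemma frame_expand:
  assumes "orthonormal_frame b L e" "v \<in> L"
  shows "(\<Sum>i<dim L. b v (e i) *\<^sub>R e i) = v"
  using orthonormal_expand[OF frame_orthonormal[OF assms(1)]] assms unfolding orthonormal_frame_def by blast

lemma parseval:
  assumes "orthonormal_frame b L e" "v \<in> L"
  shows "b v w = (\<Sum>i<dim L. b v (e i) * b w (e i))"
proof -
  have "b v w = b (\<Sum>i<dim L. b v (e i) *\<^sub>R e i) w" using frame_expand[OF assms] by simp
  then show ?thesis by (simp only: sum_left scale_left real_scaleR_def sym[of w])
qed

section \<open>Independence of traces and norms from the frame\<close>

text \<open>Connects the trace in \<open>ricci\<close>, taken with the dot product in
  \<open>Basis\<close>, to frames orthonormal for the metric: each basis vector is expanded in the
  frame, the sums are swapped, and each \<open>T (e i)\<close> is reassembled from its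
  coordinates.\<close>

lemma trace_eq_frame_sum:
  assumes e: "orthonormal_frame b UNIV e" and T: "linear T"
  shows "(\<Sum>k\<in>Basis. T k \<bullet> k) = (\<Sum>i<DIM('e). b (T (e i)) (e i))"
proof -
  have "T k \<bullet> k = (\<Sum>i<DIM('e). b k (e i) * (T (e i) \<bullet> k))" for k
  proof -
    have "T k = T (\<Sum>i<DIM('e). b k (e i) *\<^sub>R e i)" using frame_expand[OF e, of k] by simp
    also have "\<dots> = (\<Sum>i<DIM('e). b k (e i) *\<^sub>R T (e i))"
      by (simp only: linear_sum[OF T] linear_scale[OF T])
    finally have "T k \<bullet> k = (\<Sum>i<DIM('e). b k (e i) *\<^sub>R T (e i)) \<bullet> k" by (rule arg_cong)
    then show ?thesis by (simp only: inner_sum_left inner_scaleR_left)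
  qed
  then have "(\<Sum>k\<in>Basis. T k \<bullet> k) = (\<Sum>k\<in>Basis. \<Sum>i<DIM('e). b k (e i) * (T (e i) \<bullet> k))"
    by (intro sum.cong refl)
  also have "\<dots> = (\<Sum>i<DIM('e). \<Sum>k\<in>Basis. b k (e i) * (T (e i) \<bullet> k))" by (rule sum.swap)
  also have "\<dots> = (\<Sum>i<DIM('e). b (\<Sum>k\<in>Basis. (T (e i) \<bullet> k) *\<^sub>R k) (e i))"
    by (simp add: sum_left scale_left mult.commute)
  finally show ?thesis by (simp add: euclidean_representation)
qed

text \<open>By Parseval the matrix of the numbers \<open>b (e i) (e' j)\<close> is orthogonal;
  summing the expansion of \<open>a (e i) (e i)\<close> over \<open>i\<close> leaves only its
  diagonal part.\<close>

lemma form_trace_invariant: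
  fixes a :: "'e \<Rightarrow> 'e \<Rightarrow> real"
  assumes e: "orthonormal_frame b UNIV e" and e': "orthonormal_frame b UNIV e'" and a: "bilinear a"
  shows "(\<Sum>i<DIM('e). a (e i) (e i)) = (\<Sum>i<DIM('e). a (e' i) (e' i))"
proof -
  let ?n = "DIM('e)"
  have on: "orthonormal ?n e'" using frame_orthonormal[OF e'] by simp
  have ex: "a u u = (\<Sum>j<?n. \<Sum>k<?n. b u (e' j) * b u (e' k) * a (e' j) (e' k))" for u
  proof -
    have "a u u = a (\<Sum>j<?n. b u (e' j) *\<^sub>R e' j) (\<Sum>k<?n. b u (e' k) *\<^sub>R e' k)"
      using frame_expand[OF e', of u] by simp
    then show ?thesis
      unfolding bilinear_sum[OF a] sum.cartesian_product[symmetric]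
      by (simp only: bilinear_lmul[OF a] bilinear_rmul[OF a] prod.case real_scaleR_def ac_simps)
  qed
  have par: "(\<Sum>i<?n. b (e i) (e' j) * b (e i) (e' k)) = b (e' j) (e' k)" for j k
    using parseval[OF e, of "e' j" "e' k"] by (simp add: sym)
  have "(\<Sum>i<?n. a (e i) (e i)) = (\<Sum>i<?n. \<Sum>j<?n. \<Sum>k<?n. b (e i) (e' j) * b (e i) (e' k) * a (e' j) (e' k))"
    using ex by simp
  also have "\<dots> = (\<Sum>j<?n. \<Sum>i<?n. \<Sum>k<?n. b (e i) (e' j) * b (e i) (e' k) * a (e' j) (e' k))"
    by (rule sum.swap)
  also have "\<dots> = (\<Sum>j<?n. \<Sum>k<?n. \<Sum>i<?n. b (e i) (e' j) * b (e i) (e' k) * a (e' j) (e' k))"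
    by (intro sum.cong refl sum.swap)
  also have "\<dots> = (\<Sum>j<?n. \<Sum>k<?n. a (e' j) (e' k) * b (e' j) (e' k))"
    unfolding sum_distrib_right[symmetric] par by (simp add: mult.commute)
  also have "\<dots> = (\<Sum>j<?n. a (e' j) (e' j))"
    by (intro sum.cong refl orthonormal_coefficients(2)[OF on]) auto
  finally show ?thesis .
qed

lemma bilinear_mult_linear:
  fixes f g :: "'e \<Rightarrow> real"
  assumes "linear f" "linear g"
  shows "bilinear (\<lambda>v w. f v * g w)"
  unfolding bilinear_def
  by (auto intro!: linearI simp: linear_add[OF assms(1)] linear_add[OF assms(2)]
      linear_scale[OF assms(1)] linear_scale[OF assms(2)] algebra_simps)

text \<open>For fixed \<open>u\<close> and \<open>v\<close> the product of the linear forms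
  \<open>a u\<close> and \<open>a v\<close> is a bilinear form, and the sum is its trace.\<close>

lemma form_row_invariant:
  fixes a :: "'e \<Rightarrow> 'e \<Rightarrow> real"
  assumes e: "orthonormal_frame b UNIV e" and e': "orthonormal_frame b UNIV e'" and a: "bilinear a"
  shows "(\<Sum>i<DIM('e). a u (e i) * a v (e i)) = (\<Sum>i<DIM('e). a u (e' i) * a v (e' i))"
  by (rule form_trace_invariant[OF e e' bilinear_mult_linear]) (use a in \<open>auto simp: bilinear_def\<close>)

text \<open>The squared norm is the trace of the form that pairs the rows of \<open>a\<close>:
  invariance of the trace changes the frame in the outer index, invariance of row products in the
  inner one.\<close>

lemma form_norm_invariant:
  fixes a :: "'e \<Rightarrow> 'e \<Rightarrow> real"
  assumes e: "orthonormal_frame b UNIV e" and e': "orthonormal_frame b UNIV e'" and a: "bilinear a"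
  shows "(\<Sum>i<DIM('e). \<Sum>j<DIM('e). (a (e i) (e j))\<^sup>2) = (\<Sum>i<DIM('e). \<Sum>j<DIM('e). (a (e' i) (e' j))\<^sup>2)"
proof -
  have "bilinear (\<lambda>v w. \<Sum>j<DIM('e). a v (e j) * a w (e j))"
    unfolding bilinear_def
    by (auto intro!: linearI simp: bilinear_ladd[OF a] bilinear_lmul[OF a] algebra_simps
        sum.distrib sum_distrib_left)
  from form_trace_invariant[OF e e' this] form_row_invariant[OF e e' a]
  show ?thesis by (simp add: power2_eq_square)
qed

section \<open>Hyperplanes and their unit normals\<close>

text \<open>The normal takes the last index \<open>DIM('e) - 1\<close>, so the entries below it
  remain the given frame of \<open>L\<close>.\<close>

lemma hyperplane_extend_frame:
  assumes L: "L \<in> hyperplanes" and e: "orthonormal_frame b L e"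
  obtains v where "b v v = 1" "orthonormal_frame b UNIV (e(DIM('e) - 1 := v))"
proof -
  have d: "dim L = DIM('e) - 1" "subspace L" using L unfolding hyperplanes_def by auto
  have n: "Suc (DIM('e) - 1) = DIM('e)" by simp
  have on: "orthonormal (DIM('e) - 1) e" using frame_orthonormal[OF e] d by simp
  obtain v where v: "b v v = 1" "\<And>i. i < DIM('e) - 1 \<Longrightarrow> b v (e i) = 0"
    using orthonormal_extend[OF on subspace_UNIV] by auto
  have "orthonormal (dim (UNIV::'e set)) (e(DIM('e) - 1 := v))"
    using orthonormal_upd[OF on v] n by simp
  then show ?thesis using that v(1) orthonormal_imp_frame[OF _ subspace_UNIV] by auto
qed

text \<open>The orthogonal complement of \<open>v\<close> for \<open>b\<close> is the dot product
  hyperplane with normal \<open>gram v\<close>, which gives its dimension. The second conclusion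
  covers every frame of \<open>L\<close>, in particular the one chosen by
  \<open>some_frame\<close>.\<close>

lemma unit_normal_hyperplane:
  assumes v: "b v v = 1"
  obtains L where "L \<in> hyperplanes"
    "\<And>e. orthonormal_frame b L e \<Longrightarrow> orthonormal_frame b UNIV (e(DIM('e) - 1 := v))"
proof
  let ?L = "{w. b v w = 0}"
  have L: "subspace ?L" unfolding subspace_def by (auto simp: zero_right add_right scale_right)
  have "v \<noteq> 0" using v zero_left by auto
  then have "gram v \<noteq> 0" using inj_gram linear_injective_0[OF linear_gram] by blast
  then have d: "dim ?L = DIM('e) - 1" using dim_hyperplane[of "gram v"] by (simp add: gram_inner)
  show "?L \<in> hyperplanes" unfolding hyperplanes_def using L d by simp
  fix e assume e: "orthonormal_frame b ?L e"
  have on: "orthonormal (DIM('e) - 1) e" using frame_orthonormal[OF e] d by simp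
  have "b v (e i) = 0" if "i < DIM('e) - 1" for i
  proof -
    have "e i \<in> span (e ` {..<dim ?L})" using that d by (intro span_base) auto
    then show ?thesis using e unfolding orthonormal_frame_def by blast
  qed
  then have "orthonormal (dim (UNIV::'e set)) (e(DIM('e) - 1 := v))"
    using orthonormal_upd[OF on v] by simp
  then show "orthonormal_frame b UNIV (e(DIM('e) - 1 := v))"
    using orthonormal_imp_frame[OF _ subspace_UNIV] by auto
qed

text \<open>Closed by continuity of \<open>b\<close>; bounded because Parseval bounds every
  coefficient in a fixed orthonormal frame by 1.\<close>

lemma compact_unit_sphere: "compact {v. b v v = 1}"
proof -
  have c: "continuous_on UNIV (\<lambda>v. b v v)"
    using bilinear_continuous_on_compose[OF continuous_on_id continuous_on_id bilinear] by simp
  have "closed {v. b v v = 1}" using closed_Collect_eq[OF c continuous_on_const] by simp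
  moreover have "bounded {v. b v v = 1}"
  proof -
    obtain e where e: "orthonormal_frame b UNIV e" using frame_exists[OF subspace_UNIV] by blast
    have "norm v \<le> (\<Sum>i<DIM('e). norm (e i))" if v: "b v v = 1" for v
    proof -
      have le: "\<bar>b v (e i)\<bar> \<le> 1" if i: "i < DIM('e)" for i
      proof -
        have "(b v (e i))\<^sup>2 \<le> (\<Sum>i<DIM('e). (b v (e i))\<^sup>2)"
          using i by (intro member_le_sum) auto
        also have "\<dots> = 1" using parseval[OF e, of v v] v by (simp add: power2_eq_square)
        finally show ?thesis by (simp add: abs_square_le_1)
      qed
      have "norm v = norm (\<Sum>i<DIM('e). b v (e i) *\<^sub>R e i)"
        using frame_expand[OF e, of v] by simp
      also have "\<dots> \<le> (\<Sum>i<DIM('e). norm (b v (e i) *\<^sub>R e i))" by (rule norm_sum)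
      also have "\<dots> \<le> (\<Sum>i<DIM('e). norm (e i))"
        using le by (intro sum_mono) (simp add: mult_left_le_one_le)
      finally show ?thesis .
    qed
    then show ?thesis unfolding bounded_iff by blast
  qed
  ultimately show ?thesis by (simp add: compact_eq_bounded_closed)
qed

lemma polarization:
  fixes a :: "'e \<Rightarrow> 'e \<Rightarrow> real"
  assumes a: "bilinear a" and s: "\<And>u v. a u v = a v u" and q: "\<And>u. a u u = \<mu> * b u u"
  shows "a u v = \<mu> * b u v"
proof -
  have "a (u + v) (u + v) = a u u + 2 * a u v + a v v"
    using s[of u v] by (simp add: bilinear_ladd[OF a] bilinear_radd[OF a])
  moreover have "b (u + v) (u + v) = b u u + 2 * b u v + b v v"
    using sym[of u v] by (simp add: add_left add_right)
  ultimately show ?thesis using q[of u] q[of v] q[of "u + v"] by (simp add: algebra_simps)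
qed

text \<open>Independence makes the component \<open>w\<close> of \<open>v\<close> orthogonal to
  \<open>u\<close> nonzero, and the determinant is \<open>b u u * b w w\<close>.\<close>

lemma gram_determinant_pos:
  assumes "u \<noteq> v" "independent {u, v}"
  shows "0 < b u u * b v v - (b u v)\<^sup>2"
proof -
  have u: "u \<noteq> 0" using assms(2) dependent_zero by blast
  define w where "w = v - (b u v / b u u) *\<^sub>R u"
  have "w \<noteq> 0"
  proof
    assume "w = 0"
    then have "v \<in> span {u}" unfolding w_def by (simp add: span_singleton)
    moreover have "u \<noteq> v \<Longrightarrow> {u, v} - {v} = {u}" by auto
    ultimately have "dependent {u, v}" unfolding dependent_def using assms(1) by auto
    then show False using assms(2) by simp
  qed
  then have "0 < b w w" by (rule pos)
  also have "b w w = (b u u * b v v - (b u v)\<^sup>2) / b u u"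
    unfolding w_def using pos[OF u] sym[of u v]
    by (simp add: diff_left diff_right scale_left scale_right field_simps power2_eq_square)
  finally show ?thesis using pos[OF u] by (simp add: zero_less_divide_iff)
qed

end

section \<open>The Levi-Civita connection and the Gauss equation\<close>

lemma frechet_derivative_along:
  assumes "(f has_derivative f') (at x)" "g differentiable (at (f x))"
  shows "((\<lambda>y. g (f y)) has_derivative (\<lambda>u. frechet_derivative g (at (f x)) (f' u))) (at x)"
  using diff_chain_at[OF assms(1) assms(2)[unfolded frechet_derivative_works]] by (simp add: o_def)

text \<open>The Christoffel symbols of the first kind. They are explicit in the derivatives of the
  metric, so linearity, symmetry and differentiability are visible without inverting it.\<close>

definition koszul :: "'e::euclidean_space local_metric \<Rightarrow> 'e \<Rightarrow> 'e \<Rightarrow> 'e \<Rightarrow> 'e \<Rightarrow> real" where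
  "koszul G x u v w =
    (frechet_derivative (\<lambda>y. G y v w) (at x) u
     + frechet_derivative (\<lambda>y. G y u w) (at x) v
     - frechet_derivative (\<lambda>y. G y u v) (at x) w) / 2"

locale metric_domain =
  fixes U :: "'e::euclidean_space set" and G :: "'e local_metric"
  assumes open_domain: "open U"
    and ip: "x \<in> U \<Longrightarrow> ip_form (G x)"
    and smooth: "smooth_on U (\<lambda>x. G x u v)"
begin

abbreviation \<Gamma> where "\<Gamma> \<equiv> christoffel G"

lemma bilinear_metric: "x \<in> U \<Longrightarrow> bilinear (G x)"
  using ip_form.bilinear[OF ip] .

lemma differentiable_metric: "x \<in> U \<Longrightarrow> (\<lambda>y. G y u v) differentiable (at x)"
  using smooth smooth_on_imp_differentiable by blast

lemma bilinear_dmetric: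
  "x \<in> U \<Longrightarrow> bilinear (\<lambda>v w. frechet_derivative (\<lambda>y. G y v w) (at x) u)"
  by (rule bilinear_frechet_derivative_field[OF open_domain])
    (auto simp: bilinear_metric differentiable_metric)

lemma linear_dmetric: "x \<in> U \<Longrightarrow> linear (\<lambda>u. frechet_derivative (\<lambda>y. G y v w) (at x) u)"
  using linear_frechet_derivative[OF differentiable_metric] by simp

lemma dmetric_sym:
  "x \<in> U \<Longrightarrow> frechet_derivative (\<lambda>y. G y v w) (at x) = frechet_derivative (\<lambda>y. G y w v) (at x)"
  by (rule frechet_derivative_cong_open[OF open_domain]) (auto simp: ip_form.sym[OF ip])

lemma koszul_linear:
  assumes "x \<in> U"
  shows "linear (koszul G x u v)" "linear (\<lambda>u. koszul G x u v w)" "linear (\<lambda>v. koszul G x u v w)"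
  unfolding koszul_def
  by (rule linearI; simp add: bilinear_ladd[OF bilinear_dmetric[OF assms]] bilinear_radd[OF bilinear_dmetric[OF assms]]
      bilinear_lmul[OF bilinear_dmetric[OF assms]] bilinear_rmul[OF bilinear_dmetric[OF assms]]
      linear_add[OF linear_dmetric[OF assms]] linear_scale[OF linear_dmetric[OF assms]]; simp add: field_simps)+

lemma koszul_sym: "x \<in> U \<Longrightarrow> koszul G x u v w = koszul G x v u w"
  unfolding koszul_def using dmetric_sym[of x u v] by simp

lemma christoffel_koszul:
  assumes x: "x \<in> U"
  shows "G x (\<Gamma> x u v) w = koszul G x u v w"
proof -
  have "\<exists>!z. \<forall>w. G x z w = koszul G x u v w"
    using ip_form.riesz[OF ip[OF x] koszul_linear(1)[OF x]] .
  then have "\<forall>w. G x (THE z. \<forall>w. G x z w = koszul G x u v w) w = koszul G x u v w"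
    by (rule theI')
  moreover have "\<Gamma> x u v = (THE z. \<forall>w. G x z w = koszul G x u v w)"
    unfolding christoffel_def koszul_def by (simp add: field_simps)
  ultimately show ?thesis by simp
qed

lemma christoffel_sym: "x \<in> U \<Longrightarrow> \<Gamma> x u v = \<Gamma> x v u"
  by (rule ip_form.eq_I[OF ip]) (auto simp: christoffel_koszul koszul_sym)

lemma bilinear_christoffel:
  assumes x: "x \<in> U"
  shows "bilinear (\<Gamma> x)"
proof -
  interpret ip_form "G x" using ip[OF x] .
  show ?thesis
    unfolding bilinear_def
    by (intro conjI allI linearI; rule eq_I;
        simp add: christoffel_koszul[OF x] add_left scale_left
          linear_add[OF koszul_linear(2)[OF x]] linear_scale[OF koszul_linear(2)[OF x]]
          linear_add[OF koszul_linear(3)[OF x]] linear_scale[OF koszul_linear(3)[OF x]])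
qed

text \<open>In the sum of the Koszul expressions with \<open>v\<close> and \<open>w\<close>
  exchanged, everything cancels except the derivative in direction \<open>u\<close>.\<close>

lemma metric_compatible:
  assumes "x \<in> U"
  shows "frechet_derivative (\<lambda>y. G y v w) (at x) u = G x (\<Gamma> x u v) w + G x v (\<Gamma> x u w)"
  unfolding ip_form.sym[OF ip[OF assms], of v] christoffel_koszul[OF assms] koszul_def
  using dmetric_sym[OF assms, of v w] dmetric_sym[OF assms, of v u] dmetric_sym[OF assms, of w u]
  by (simp add: field_simps)

lemma has_derivative_koszul:
  assumes x: "x \<in> U"
  shows "((\<lambda>y. koszul G y u v w) has_derivative (\<lambda>s.
    (frechet_derivative (\<lambda>y. frechet_derivative (\<lambda>z. G z v w) (at y) u) (at x) s
     + frechet_derivative (\<lambda>y. frechet_derivative (\<lambda>z. G z u w) (at y) v) (at x) s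
     - frechet_derivative (\<lambda>y. frechet_derivative (\<lambda>z. G z u v) (at y) w) (at x) s) / 2)) (at x)"
  unfolding koszul_def
  by (auto intro!: derivative_eq_intros smooth_on_imp_has_derivative[OF smooth_on_frechet_derivative[OF smooth] x])

text \<open>The Christoffel symbol solves a linear equation whose coefficients are differentiable; it is
  differentiable because \<open>(y, z) \<mapsto> (y, gram\<^sub>y z)\<close> is invertible with invertible derivative.\<close>

lemma differentiable_christoffel:
  assumes x: "x \<in> U"
  shows "(\<lambda>y. \<Gamma> y u v) differentiable (at x)"
proof -
  define \<Phi> :: "'e \<times> 'e \<Rightarrow> 'e \<times> 'e" where "\<Phi> = (\<lambda>p. (fst p, ip_form.gram (G (fst p)) (snd p)))"
  define \<Psi> :: "'e \<times> 'e \<Rightarrow> 'e \<times> 'e" where "\<Psi> = (\<lambda>p. (fst p, inv (ip_form.gram (G (fst p))) (snd p)))"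
  have S: "open (U \<times> (UNIV::'e set))" using open_domain by (simp add: open_Times)
  have gram: "ip_form.gram (G y) z = (\<Sum>k\<in>Basis. G y z k *\<^sub>R k)" if "y \<in> U" for y z
    using ip_form.gram_def[OF ip[OF that]] .
  \<comment> \<open>The derivative at \<open>x\<close> of the Gram map in its base point, with the
    vector \<open>z\<close> held fixed.\<close>
  define d where "d = (\<lambda>z s. \<Sum>k\<in>Basis. frechet_derivative (\<lambda>y. G y z k) (at x) s *\<^sub>R k)"
  have der: "(\<Phi> has_derivative (\<lambda>q. (fst q, d z (fst q) + ip_form.gram (G y) (snd q)))) (at (y, z))"
    if "y = x" for y z
  proof -
    have m: "((\<lambda>p. G (fst p) (snd p) k) has_derivative
        (\<lambda>q. frechet_derivative (\<lambda>y. G y z k) (at x) (fst q) + G x (snd q) k)) (at (x, z))" for k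
    proof -
      have fs: "((\<lambda>p. G (fst p) v w) has_derivative
          (\<lambda>q. frechet_derivative (\<lambda>y. G y v w) (at x) (fst q))) (at (x, z))" for v w
        using frechet_derivative_along[OF bounded_linear_imp_has_derivative[OF bounded_linear_fst],
            of "\<lambda>y. G y v w" "(x, z)"] differentiable_metric[OF x] by simp
      have "((\<lambda>p. G (fst p) (snd p) k) has_derivative (\<lambda>q.
          frechet_derivative (\<lambda>p. G (fst p) (snd (x, z)) k) (at (x, z)) q
          + G (fst (x, z)) (snd q) k + G (fst (x, z)) (snd (x, z)) 0)) (at (x, z))"
        using x fs
        by (intro has_derivative_bilinear_field[OF S])
          (auto intro!: bounded_linear_imp_has_derivative bounded_linear_snd differentiableI simp: bilinear_metric)
      then show ?thesis
        by (simp add: frechet_derivative_at[OF fs, symmetric] ip_form.zero_right[OF ip[OF x]])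
    qed
    have "((\<lambda>p. (fst p, \<Sum>k\<in>Basis. G (fst p) (snd p) k *\<^sub>R k)) has_derivative
        (\<lambda>q. (fst q, \<Sum>k\<in>Basis. (frechet_derivative (\<lambda>y. G y z k) (at x) (fst q) + G x (snd q) k) *\<^sub>R k))) (at (x, z))"
      by (intro has_derivative_Pair has_derivative_sum has_derivative_scaleR_left m
          bounded_linear_imp_has_derivative[OF bounded_linear_fst])
    then have "((\<lambda>p. (fst p, \<Sum>k\<in>Basis. G (fst p) (snd p) k *\<^sub>R k)) has_derivative
        (\<lambda>q. (fst q, d z (fst q) + ip_form.gram (G x) (snd q)))) (at (x, z))"
      unfolding d_def gram[OF x] by (simp add: scaleR_left_distrib sum.distrib)
    then show ?thesis unfolding that
      by (rule has_derivative_transform_within_open[OF _ S]) (use x in \<open>auto simp: \<Phi>_def gram\<close>)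
  qed
  \<comment> \<open>The theorem on derivatives of inverses asks for continuity on the whole open
    set, beyond differentiability at one point.\<close>
  have cont: "continuous_on (U \<times> UNIV) \<Phi>"
  proof -
    have "continuous_on (U \<times> UNIV) (\<lambda>p. (fst p, \<Sum>k\<in>Basis. (\<Sum>i\<in>Basis. \<Sum>j\<in>Basis.
        ((snd p \<bullet> i) * (k \<bullet> j)) *\<^sub>R G (fst p) i j) *\<^sub>R k))"
      by (intro continuous_intros continuous_on_compose2[OF smooth_on_imp_continuous_on[OF smooth]]) auto
    moreover have "(\<Sum>i\<in>Basis. \<Sum>j\<in>Basis. ((z \<bullet> i) * (k \<bullet> j)) *\<^sub>R G y i j) = G y z k" if "y \<in> U" for y z k
      by (rule bilinear_expand[OF bilinear_metric[OF that], symmetric])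
    ultimately show ?thesis
      by (elim continuous_on_eq) (auto simp: \<Phi>_def gram)
  qed
  have inv: "\<Psi> (\<Phi> p) = p" if "p \<in> U \<times> UNIV" for p
    using that ip_form.inj_gram[OF ip] by (auto simp: \<Phi>_def \<Psi>_def inv_f_f)
  define z where "z = \<Gamma> x u v"
  define K where "K = (\<lambda>y. \<Sum>k\<in>Basis. koszul G y u v k *\<^sub>R k)"
  have gK: "ip_form.gram (G y) (\<Gamma> y u v) = K y" if "y \<in> U" for y
    unfolding gram[OF that] K_def by (simp add: christoffel_koszul[OF that])
  let ?L = "ip_form.gram (G x)"
  \<comment> \<open>The linearisation of \<open>\<Phi>\<close> is block triangular with diagonal
    blocks \<open>id\<close> and \<open>?L\<close>; this is its inverse, found by solving for the
    second component.\<close>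
  let ?g' = "\<lambda>q. (fst q, inv ?L (snd q - d z (fst q)))"
  have "(\<lambda>q. (fst q, d z (fst q) + ?L (snd q))) \<circ> ?g' = id"
    using ip_form.bij_gram[OF ip[OF x]] by (auto simp: fun_eq_iff bij_is_surj surj_f_inv_f)
  then have "(\<Psi> has_derivative ?g') (at (\<Phi> (x, z)))"
    using has_derivative_inverse_strong[OF S _ cont inv der] x by blast
  then have psi: "\<Psi> differentiable (at (x, K x))"
    unfolding \<Phi>_def using gK[OF x] z_def differentiableI by auto
  have "(\<lambda>y. koszul G y u v k) differentiable (at x)" for k
    using has_derivative_koszul[OF x] differentiableI by blast
  then have "K differentiable (at x)"
    unfolding K_def by (intro differentiable_sum) auto
  then have "(\<lambda>y. (y, K y)) differentiable (at x)"
    unfolding differentiable_def using has_derivative_Pair[OF has_derivative_ident] by blast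
  from differentiable_chain_at[OF this psi]
  have "(\<lambda>y. snd (\<Psi> (y, K y))) differentiable (at x)"
    unfolding differentiable_def o_def using has_derivative_snd by blast
  then obtain D where "((\<lambda>y. snd (\<Psi> (y, K y))) has_derivative D) (at x)"
    unfolding differentiable_def by blast
  then have "((\<lambda>y. \<Gamma> y u v) has_derivative D) (at x)"
    by (rule has_derivative_transform_within_open[OF _ open_domain x])
      (use ip_form.inj_gram[OF ip] in \<open>auto simp: \<Psi>_def gK[symmetric] inv_f_f\<close>)
  then show ?thesis using differentiableI by blast
qed

text \<open>Leibniz rule for the metric pulled back by \<open>f\<close>, chain rule for the part
  with frozen fields, then compatibility at \<open>f x\<close>. It is applied with \<open>f\<close>
  the identity for intrinsic formulas and with \<open>f\<close> the immersion for fields along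
  it.\<close>

lemma metric_compatible_along:
  assumes V: "open V" "x \<in> V" "f ` V \<subseteq> U" and f: "f differentiable (at x)"
    and X: "X differentiable (at x)" and Y: "Y differentiable (at x)"
  shows "frechet_derivative (\<lambda>y. G (f y) (X y) (Y y)) (at x) u =
    G (f x) (frechet_derivative X (at x) u + \<Gamma> (f x) (frechet_derivative f (at x) u) (X x)) (Y x)
    + G (f x) (X x) (frechet_derivative Y (at x) u + \<Gamma> (f x) (frechet_derivative f (at x) u) (Y x))"
proof -
  have fx: "f x \<in> U" using V by auto
  interpret ip_form "G (f x)" using ip[OF fx] .
  have d: "((\<lambda>y. G (f y) v w) has_derivative
      (\<lambda>u. frechet_derivative (\<lambda>y. G y v w) (at (f x)) (frechet_derivative f (at x) u))) (at x)" for v w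
    by (rule frechet_derivative_along[OF f[unfolded frechet_derivative_works] differentiable_metric[OF fx]])
  have "frechet_derivative (\<lambda>y. G (f y) (X y) (Y y)) (at x) u =
     frechet_derivative (\<lambda>y. G (f y) (X x) (Y x)) (at x) u
     + G (f x) (frechet_derivative X (at x) u) (Y x) + G (f x) (X x) (frechet_derivative Y (at x) u)"
    using V d by (intro frechet_derivative_bilinear_field[OF V(1,2) _ _ X Y])
      (auto intro!: bilinear_metric differentiableI)
  also have "frechet_derivative (\<lambda>y. G (f y) (X x) (Y x)) (at x) u
     = frechet_derivative (\<lambda>y. G y (X x) (Y x)) (at (f x)) (frechet_derivative f (at x) u)"
    using fun_cong[OF frechet_derivative_at[OF d], of "X x" "Y x" u] by simp
  finally show ?thesis by (simp add: metric_compatible[OF fx] add_left add_right)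
qed

section \<open>Riemann and Ricci curvature\<close>

text \<open>Differentiating \<open>G y (\<Gamma> y v w) z\<close> along \<open>u\<close> gives the
  iterated covariant derivative paired with \<open>z\<close>, plus a product of Christoffel symbols.
  Curvature is thereby expressed through derivatives of \<open>koszul\<close>.\<close>

lemma riemann_koszul:
  assumes x: "x \<in> U"
  shows "G x (riemann G x u v w) z =
    frechet_derivative (\<lambda>y. koszul G y v w z) (at x) u - frechet_derivative (\<lambda>y. koszul G y u w z) (at x) v
    - G x (\<Gamma> x v w) (\<Gamma> x u z) + G x (\<Gamma> x u w) (\<Gamma> x v z)"
proof -
  interpret ip_form "G x" using ip[OF x] .
  have "frechet_derivative (\<lambda>y. koszul G y v w z) (at x) u =
    G x (frechet_derivative (\<lambda>y. \<Gamma> y v w) (at x) u + \<Gamma> x u (\<Gamma> x v w)) z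
    + G x (\<Gamma> x v w) (\<Gamma> x u z)" for u v
  proof -
    have "frechet_derivative (\<lambda>y. koszul G y v w z) (at x) u = frechet_derivative (\<lambda>y. G y (\<Gamma> y v w) z) (at x) u"
      by (rule fun_cong[OF frechet_derivative_cong_open[OF open_domain x]]) (simp add: christoffel_koszul)
    then show ?thesis
      using metric_compatible_along[OF open_domain x, of "\<lambda>y. y" "\<lambda>y. \<Gamma> y v w" "\<lambda>y. z" u]
        differentiable_christoffel[OF x] by simp
  qed
  then show ?thesis unfolding riemann_def by (simp add: diff_left)
qed

text \<open>The case of pair symmetry needed for the symmetry of Ricci. Written in second
  derivatives of the metric, the expression is visibly symmetric, since those derivatives are
  symmetric in the two metric slots and in the two directions.\<close>

lemma riemann_sectional_sym:
  assumes x: "x \<in> U"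
  shows "G x (riemann G x e u v) e = G x (riemann G x e v u) e"
proof -
  interpret ip_form "G x" using ip[OF x] .
  define Q where "Q = (\<lambda>p q r s. frechet_derivative (\<lambda>y. frechet_derivative (\<lambda>z. G z p q) (at y) r) (at x) s)"
  have dd: "frechet_derivative (\<lambda>y. koszul G y p q r) (at x) s = (Q q r p s + Q p r q s - Q p q r s) / 2" for p q r s
    unfolding Q_def
    by (rule fun_cong[OF frechet_derivative_at[OF has_derivative_koszul[OF x]], symmetric])
  have Q1: "Q p q r s = Q p q s r" for p q r s
    unfolding Q_def by (rule second_derivative_symmetric[OF smooth open_domain x])
  have Q2: "Q p q r s = Q q p r s" for p q r s
    unfolding Q_def by (rule fun_cong[OF frechet_derivative_cong_open[OF open_domain x]]) (simp add: dmetric_sym)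
  have "G x (riemann G x e p q) e = (Q q e p e + Q p e q e - Q p q e e - Q e e p q) / 2
     - G x (\<Gamma> x p q) (\<Gamma> x e e) + G x (\<Gamma> x e p) (\<Gamma> x e q)" for p q
    unfolding riemann_koszul[OF x] dd
    using Q2[of e q e p] Q1[of e e q p] christoffel_sym[OF x, of p e] sym[of "\<Gamma> x e q" "\<Gamma> x e p"]
    by (simp add: field_simps)
  note this[of u v] this[of v u]
  moreover have "Q e e u v = Q e e v u" by (rule Q1)
  moreover have "Q u v e e = Q v u e e" by (rule Q2)
  moreover have "\<Gamma> x u v = \<Gamma> x v u" by (rule christoffel_sym[OF x])
  moreover have "G x (\<Gamma> x e u) (\<Gamma> x e v) = G x (\<Gamma> x e v) (\<Gamma> x e u)" by (rule sym)
  ultimately show ?thesis by (simp only: add.commute)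
qed

lemma riemann_alternating: "riemann G x u u w = 0"
  unfolding riemann_def by simp

lemma riemann_linear:
  assumes x: "x \<in> U"
  shows "linear (\<lambda>u. riemann G x u v w)" "linear (\<lambda>v. riemann G x u v w)" "linear (\<lambda>w. riemann G x u v w)"
proof -
  have 1: "bilinear (\<lambda>v w. frechet_derivative (\<lambda>y. \<Gamma> y v w) (at x) u)" for u
    by (rule bilinear_frechet_derivative_field[OF open_domain x])
      (auto simp: bilinear_christoffel differentiable_christoffel x)
  have 2: "linear (frechet_derivative (\<lambda>y. \<Gamma> y v w) (at x))" for v w
    by (rule linear_frechet_derivative[OF differentiable_christoffel[OF x]])
  note B = bilinear_christoffel[OF x]
  show "linear (\<lambda>u. riemann G x u v w)" "linear (\<lambda>v. riemann G x u v w)" "linear (\<lambda>w. riemann G x u v w)"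
    unfolding riemann_def
    by (rule linearI; simp add: bilinear_ladd[OF 1] bilinear_radd[OF 1] bilinear_lmul[OF 1] bilinear_rmul[OF 1]
        bilinear_ladd[OF B] bilinear_radd[OF B] bilinear_lmul[OF B] bilinear_rmul[OF B]
        linear_add[OF 2] linear_scale[OF 2] algebra_simps)+
qed

lemma ricci_frame:
  assumes x: "x \<in> U" and e: "orthonormal_frame (G x) UNIV e"
  shows "ricci G x u v = (\<Sum>i<DIM('e). G x (riemann G x (e i) u v) (e i))"
  unfolding ricci_def using ip_form.trace_eq_frame_sum[OF ip[OF x] e riemann_linear(1)[OF x]] .

lemma bilinear_ricci: "x \<in> U \<Longrightarrow> bilinear (ricci G x)"
  unfolding bilinear_def ricci_def
  by (auto intro!: linearI simp: linear_add[OF riemann_linear(2)] linear_scale[OF riemann_linear(2)]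
      linear_add[OF riemann_linear(3)] linear_scale[OF riemann_linear(3)] inner_add_left
      sum.distrib sum_distrib_left)

lemma ricci_sym:
  assumes "x \<in> U"
  shows "ricci G x u v = ricci G x v u"
proof -
  obtain e where "orthonormal_frame (G x) UNIV e" using ip_form.frame_exists[OF ip[OF assms] subspace_UNIV] by blast
  then show ?thesis using riemann_sectional_sym[OF assms] by (simp add: ricci_frame[OF assms])
qed

text \<open>For independent vectors the denominator of \<open>sectional\<close> is positive and can
  be cleared; for dependent ones both sides vanish. Without the quotient the formula also applies to
  equal frame vectors.\<close>

lemma constant_sectional:
  assumes x: "x \<in> U" and sec: "\<And>u v. u \<noteq> v \<Longrightarrow> independent {u, v} \<Longrightarrow> sectional G x u v = c"
  shows "G x (riemann G x u v v) u = c * (G x u u * G x v v - (G x u v)\<^sup>2)"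
proof -
  interpret ip_form "G x" using ip[OF x] .
  consider "u \<noteq> v" "independent {u, v}" | "u = 0" | t where "v = t *\<^sub>R u"
  proof (cases "u \<noteq> v \<and> independent {u, v} \<or> u = 0")
    case False
    then have "u = v \<or> v \<in> span {u}"
      using independent_insert[of v "{u}"] by (auto simp: insert_commute)
    then have "\<exists>t. v = t *\<^sub>R u" by (auto simp: span_singleton intro: exI[of _ 1])
    then show ?thesis using that(3) by blast
  qed (use that in auto)
  then show ?thesis
  proof cases
    case 1
    then have "0 < G x u u * G x v v - (G x u v)\<^sup>2" by (rule gram_determinant_pos)
    then show ?thesis using sec[OF 1] unfolding sectional_def by (simp add: field_simps)
  next
    case 2
    then show ?thesis by (simp add: zero_left zero_right)
  next
    case 3
    have "riemann G x u (t *\<^sub>R u) w = 0" for w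
      using linear_scale[OF riemann_linear(2)[OF x]] by (simp add: riemann_alternating)
    then show ?thesis using 3 by (simp add: zero_left scale_left scale_right power2_eq_square)
  qed
qed

end

section \<open>The second fundamental form and the Gauss equation\<close>

locale isometric_immersion =
  dom: metric_domain U G + amb: metric_domain T H
  for U :: "'e::euclidean_space set" and G :: "'e local_metric"
    and T :: "'f::euclidean_space set" and H :: "'f local_metric" +
  fixes F :: "'e \<Rightarrow> 'f"
  assumes smooth_map: "smooth_on U F" and maps_to: "F ` U \<subseteq> T"
    and isometric: "x \<in> U \<Longrightarrow>
      G x u v = H (F x) (frechet_derivative F (at x) u) (frechet_derivative F (at x) v)"
begin

abbreviation "dF x u \<equiv> frechet_derivative F (at x) u"

abbreviation "h \<equiv> second_ff F G H"

text \<open>The ambient covariant derivative of the field \<open>dF v\<close> along \<open>F\<close> in direction \<open>u\<close>.\<close>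

definition amb_deriv :: "'e \<Rightarrow> 'e \<Rightarrow> 'e \<Rightarrow> 'f" where
  "amb_deriv x u v = frechet_derivative (\<lambda>y. dF y v) (at x) u + christoffel H (F x) (dF x u) (dF x v)"

lemma second_ff_eq: "h x u v = amb_deriv x u v - dF x (christoffel G x u v)"
  unfolding second_ff_def amb_deriv_def by simp

lemma image_in: "x \<in> U \<Longrightarrow> F x \<in> T"
  using maps_to by blast

lemma linear_dF: "x \<in> U \<Longrightarrow> linear (frechet_derivative F (at x))"
  using linear_frechet_derivative smooth_on_imp_differentiable[OF smooth_map] by blast

lemma differentiable_dF: "x \<in> U \<Longrightarrow> (\<lambda>y. dF y v) differentiable (at x)"
  using smooth_on_imp_differentiable smooth_on_frechet_derivative[OF smooth_map] by blast

lemma has_derivative_F: "x \<in> U \<Longrightarrow> (F has_derivative frechet_derivative F (at x)) (at x)"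
  using smooth_on_imp_has_derivative[OF smooth_map] .

lemma hessian_sym:
  "x \<in> U \<Longrightarrow> frechet_derivative (\<lambda>y. dF y v) (at x) u = frechet_derivative (\<lambda>y. dF y u) (at x) v"
  using second_derivative_symmetric[OF smooth_map dom.open_domain] .

lemma amb_deriv_sym: "x \<in> U \<Longrightarrow> amb_deriv x u v = amb_deriv x v u"
  unfolding amb_deriv_def using hessian_sym amb.christoffel_sym image_in by metis

lemma bilinear_amb_deriv:
  assumes x: "x \<in> U"
  shows "bilinear (amb_deriv x)"
proof -
  have l: "linear (\<lambda>u. frechet_derivative (\<lambda>y. dF y v) (at x) u)" for v
    using linear_frechet_derivative[OF differentiable_dF[OF x]] by simp
  have r: "linear (\<lambda>v. frechet_derivative (\<lambda>y. dF y v) (at x) u)" for u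
    using l[of u] hessian_sym[OF x] by simp
  note B = amb.bilinear_christoffel[OF image_in[OF x]] and L = linear_dF[OF x]
  show ?thesis
    unfolding bilinear_def amb_deriv_def
    by (auto intro!: linearI simp: linear_add[OF l] linear_scale[OF l] linear_add[OF r] linear_scale[OF r]
        linear_add[OF L] linear_scale[OF L] bilinear_ladd[OF B] bilinear_radd[OF B] bilinear_lmul[OF B]
        bilinear_rmul[OF B] scaleR_right_distrib)
qed

lemma bilinear_second_ff:
  assumes x: "x \<in> U"
  shows "bilinear (h x)"
proof -
  note A = bilinear_amb_deriv[OF x] and B = dom.bilinear_christoffel[OF x] and L = linear_dF[OF x]
  show ?thesis
    unfolding bilinear_def second_ff_eq
    by (auto intro!: linearI simp: linear_add[OF L] linear_scale[OF L] bilinear_ladd[OF B] bilinear_radd[OF B]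
        bilinear_lmul[OF B] bilinear_rmul[OF B] bilinear_ladd[OF A] bilinear_radd[OF A]
        bilinear_lmul[OF A] bilinear_rmul[OF A] scaleR_right_diff_distrib)
qed

lemma second_ff_sym: "x \<in> U \<Longrightarrow> h x u v = h x v u"
  unfolding second_ff_eq using amb_deriv_sym dom.christoffel_sym by metis

text \<open>Differentiating the isometry relation shows that \<open>amb_deriv\<close> is compatible
  with the induced metric; being symmetric too, it satisfies the same Koszul formula as the
  intrinsic connection. Hence its tangential part is the Levi-Civita derivative.\<close>

lemma amb_deriv_koszul:
  assumes x: "x \<in> U"
  shows "H (F x) (amb_deriv x u v) (dF x z) = koszul G x u v z"
proof -
  interpret N: ip_form "H (F x)" using amb.ip[OF image_in[OF x]] .
  have "frechet_derivative (\<lambda>y. G y v z) (at x) u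
      = H (F x) (amb_deriv x u v) (dF x z) + H (F x) (dF x v) (amb_deriv x u z)" for u v z
  proof -
    have "frechet_derivative (\<lambda>y. G y v z) (at x) u = frechet_derivative (\<lambda>y. H (F y) (dF y v) (dF y z)) (at x) u"
      by (rule fun_cong[OF frechet_derivative_cong_open[OF dom.open_domain x]]) (simp add: isometric)
    also have "\<dots> = H (F x) (amb_deriv x u v) (dF x z) + H (F x) (dF x v) (amb_deriv x u z)"
      unfolding amb_deriv_def
      by (rule amb.metric_compatible_along[OF dom.open_domain x maps_to _ differentiable_dF[OF x] differentiable_dF[OF x]])
        (rule smooth_on_imp_differentiable[OF smooth_map x])
    finally show ?thesis .
  qed
  then show ?thesis unfolding koszul_def
    using N.sym[of "dF x v" "amb_deriv x u z"] N.sym[of "dF x u" "amb_deriv x v z"]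
      amb_deriv_sym[OF x, of u v] amb_deriv_sym[OF x, of u z] amb_deriv_sym[OF x, of v z] by simp
qed

lemma second_ff_normal:
  assumes x: "x \<in> U"
  shows "H (F x) (h x u v) (dF x z) = 0"
proof -
  interpret N: ip_form "H (F x)" using amb.ip[OF image_in[OF x]] .
  show ?thesis
    unfolding second_ff_eq
    by (simp add: N.diff_left amb_deriv_koszul[OF x] dom.christoffel_koszul[OF x] isometric[OF x, symmetric])
qed

text \<open>Splits both factors into normal and tangential parts; the mixed products vanish because
  \<open>h\<close> is normal.\<close>

lemma amb_deriv_inner:
  assumes x: "x \<in> U"
  shows "H (F x) (amb_deriv x u v) (amb_deriv x w z) =
    H (F x) (h x u v) (h x w z) + G x (christoffel G x u v) (christoffel G x w z)"
proof -
  interpret N: ip_form "H (F x)" using amb.ip[OF image_in[OF x]] .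
  have "amb_deriv x u v = h x u v + dF x (christoffel G x u v)" for u v unfolding second_ff_eq by simp
  then show ?thesis
    using second_ff_normal[OF x, of u v "christoffel G x w z"] second_ff_normal[OF x, of w z "christoffel G x u v"]
      N.sym[of "dF x (christoffel G x u v)"]
    by (simp add: N.add_left N.add_right isometric[OF x])
qed

lemma has_derivative_amb_deriv:
  assumes x: "x \<in> U"
  shows "((\<lambda>y. amb_deriv y v w) has_derivative (\<lambda>u.
    frechet_derivative (\<lambda>y. frechet_derivative (\<lambda>z. dF z w) (at y) v) (at x) u
    + (frechet_derivative (\<lambda>y. christoffel H y (dF x v) (dF x w)) (at (F x)) (dF x u)
       + christoffel H (F x) (frechet_derivative (\<lambda>y. dF y v) (at x) u) (dF x w)
       + christoffel H (F x) (dF x v) (frechet_derivative (\<lambda>y. dF y w) (at x) u)))) (at x)"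
proof -
  have d: "((\<lambda>y. christoffel H (F y) a b) has_derivative
      (\<lambda>u. frechet_derivative (\<lambda>y. christoffel H y a b) (at (F x)) (dF x u))) (at x)" for a b
    by (rule frechet_derivative_along[OF has_derivative_F[OF x] amb.differentiable_christoffel[OF image_in[OF x]]])
  have "((\<lambda>y. christoffel H (F y) (dF y v) (dF y w)) has_derivative (\<lambda>u.
      frechet_derivative (\<lambda>y. christoffel H (F y) (dF x v) (dF x w)) (at x) u
       + christoffel H (F x) (frechet_derivative (\<lambda>y. dF y v) (at x) u) (dF x w)
       + christoffel H (F x) (dF x v) (frechet_derivative (\<lambda>y. dF y w) (at x) u))) (at x)"
    using d differentiable_dF[OF x] unfolding frechet_derivative_works
    by (intro has_derivative_bilinear_field[OF dom.open_domain x])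
      (auto simp: amb.bilinear_christoffel image_in intro: differentiableI)
  then show ?thesis
    unfolding amb_deriv_def frechet_derivative_at[OF d, symmetric]
    by (intro has_derivative_add smooth_on_imp_has_derivative[OF _ x] smooth_on_frechet_derivative smooth_map)
qed

text \<open>The third derivatives of \<open>F\<close> cancel by symmetry, and so do the terms
  containing the Hessian of \<open>F\<close> in \<open>u\<close> and \<open>v\<close>. The terms
  with one Hessian involving \<open>w\<close> cancel crosswise against those inside
  \<open>amb_deriv\<close>.\<close>

lemma ambient_curvature:
  assumes x: "x \<in> U"
  shows "riemann H (F x) (dF x u) (dF x v) (dF x w) =
    (frechet_derivative (\<lambda>y. amb_deriv y v w) (at x) u + christoffel H (F x) (dF x u) (amb_deriv x v w))
    - (frechet_derivative (\<lambda>y. amb_deriv y u w) (at x) v + christoffel H (F x) (dF x v) (amb_deriv x u w))"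
proof -
  have e: "frechet_derivative (\<lambda>y. amb_deriv y v w) (at x) u =
    frechet_derivative (\<lambda>y. frechet_derivative (\<lambda>z. dF z w) (at y) v) (at x) u
    + (frechet_derivative (\<lambda>y. christoffel H y (dF x v) (dF x w)) (at (F x)) (dF x u)
       + christoffel H (F x) (frechet_derivative (\<lambda>y. dF y v) (at x) u) (dF x w)
       + christoffel H (F x) (dF x v) (frechet_derivative (\<lambda>y. dF y w) (at x) u))" for u v
    by (rule fun_cong[OF frechet_derivative_at[OF has_derivative_amb_deriv[OF x]], symmetric])
  have "frechet_derivative (\<lambda>y. frechet_derivative (\<lambda>z. dF z w) (at y) v) (at x) u
      = frechet_derivative (\<lambda>y. frechet_derivative (\<lambda>z. dF z w) (at y) u) (at x) v"
    by (rule second_derivative_symmetric[OF smooth_on_frechet_derivative[OF smooth_map] dom.open_domain x])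
  then show ?thesis
    unfolding riemann_def e unfolding amb_deriv_def
    using hessian_sym[OF x, of u v]
    by (simp add: bilinear_radd[OF amb.bilinear_christoffel[OF image_in[OF x]]])
qed

text \<open>The derivative of \<open>koszul\<close> is computed along the immersion and compared
  with \<open>riemann_koszul\<close>. Splitting products of ambient derivatives produces exactly the
  Christoffel products occurring there, so only the products of \<open>h\<close> survive.\<close>

theorem gauss_equation:
  assumes x: "x \<in> U"
  shows "G x (riemann G x u v w) z = H (F x) (riemann H (F x) (dF x u) (dF x v) (dF x w)) (dF x z)
    + H (F x) (h x v w) (h x u z) - H (F x) (h x u w) (h x v z)"
proof -
  interpret N: ip_form "H (F x)" using amb.ip[OF image_in[OF x]] .
  have "frechet_derivative (\<lambda>y. koszul G y v w z) (at x) u =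
    H (F x) (frechet_derivative (\<lambda>y. amb_deriv y v w) (at x) u + christoffel H (F x) (dF x u) (amb_deriv x v w)) (dF x z)
    + H (F x) (amb_deriv x v w) (amb_deriv x u z)" for u v
  proof -
    have "frechet_derivative (\<lambda>y. koszul G y v w z) (at x) u
        = frechet_derivative (\<lambda>y. H (F y) (amb_deriv y v w) (dF y z)) (at x) u"
      by (rule fun_cong[OF frechet_derivative_cong_open[OF dom.open_domain x]]) (simp add: amb_deriv_koszul)
    also have "\<dots> = H (F x) (frechet_derivative (\<lambda>y. amb_deriv y v w) (at x) u
          + christoffel H (F x) (dF x u) (amb_deriv x v w)) (dF x z)
        + H (F x) (amb_deriv x v w) (amb_deriv x u z)"
      unfolding amb_deriv_def[of x u z]
      by (rule amb.metric_compatible_along[OF dom.open_domain x maps_to])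
        (auto intro!: smooth_on_imp_differentiable[OF smooth_map x] differentiable_dF[OF x]
          differentiableI[OF has_derivative_amb_deriv[OF x]])
    finally show ?thesis .
  qed
  then show ?thesis
    unfolding dom.riemann_koszul[OF x] ambient_curvature[OF x]
    by (simp add: N.diff_left amb_deriv_inner[OF x])
qed

end

section \<open>Casorati curvatures\<close>

lemma sum_triangle_sym:
  fixes f :: "nat \<Rightarrow> nat \<Rightarrow> real"
  assumes "\<And>i j. f i j = f j i"
  shows "2 * (\<Sum>j<n. \<Sum>i<j. f i j) = (\<Sum>i<n. \<Sum>j<n. f i j) - (\<Sum>i<n. f i i)"
proof (induction n)
  case (Suc n)
  have "(\<Sum>j<n. f n j) = (\<Sum>j<n. f j n)" using assms by (intro sum.cong) auto
  then show ?case using Suc by (simp add: sum.distrib algebra_simps)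
qed simp

lemma sum_square_split:
  fixes a :: "nat \<Rightarrow> nat \<Rightarrow> real"
  assumes "\<And>i j. a i j = a j i"
  shows "(\<Sum>i<Suc m. \<Sum>j<Suc m. (a i j)\<^sup>2) =
    (\<Sum>i<m. \<Sum>j<m. (a i j)\<^sup>2) + 2 * (\<Sum>i<m. (a i m)\<^sup>2) + (a m m)\<^sup>2"
proof -
  have "(\<Sum>j<m. (a m j)\<^sup>2) = (\<Sum>j<m. (a j m)\<^sup>2)" using assms by (intro sum.cong) auto
  then show ?thesis by (simp add: sum.distrib)
qed

text \<open>Both optimality gaps are of this form, with weights \<open>(1/2, 2, 1)\<close> and \<open>(1, 1, 1/2)\<close>. The
  constant \<open>m / p + 1 / w\<close> is the one that makes Cauchy--Schwarz for the trace sharp.\<close>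

definition weighted_gap :: "nat \<Rightarrow> real \<Rightarrow> real \<Rightarrow> real \<Rightarrow> (nat \<Rightarrow> nat \<Rightarrow> real) \<Rightarrow> real" where
  "weighted_gap m p q w a =
    (real m / p + 1 / w) * (p * (\<Sum>i<m. \<Sum>j<m. (a i j)\<^sup>2) + q * (\<Sum>i<m. (a i m)\<^sup>2) + w * (a m m)\<^sup>2)
    - (\<Sum>i<Suc m. a i i)\<^sup>2"

text \<open>Completes the squares about the equality case of Cauchy-Schwarz: among diagonals with
  the given trace, the weighted sum of squares is minimal at entries \<open>s / p\<close> and
  \<open>s / w\<close>, and the trace condition fixes \<open>s\<close>.\<close>

lemma weighted_gap_eq:
  fixes a :: "nat \<Rightarrow> nat \<Rightarrow> real"
  assumes pos: "0 < p" "0 < q" "0 < w"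
    and s: "s = (\<Sum>i<Suc m. a i i) / (real m / p + 1 / w)"
  shows "weighted_gap m p q w a = (real m / p + 1 / w) *
    (p * (\<Sum>i<m. \<Sum>j\<in>{..<m} - {i}. (a i j)\<^sup>2) + q * (\<Sum>i<m. (a i m)\<^sup>2)
      + p * (\<Sum>i<m. (a i i - s / p)\<^sup>2) + w * (a m m - s / w)\<^sup>2)"
proof -
  define D where "D = real m / p + 1 / w"
  define t where "t = (\<Sum>i<m. a i i)"
  have D: "D > 0" unfolding D_def using pos by (simp add: add_nonneg_pos)
  have sD: "s * D = t + a m m" using s D unfolding D_def[symmetric] t_def by simp
  have split: "(\<Sum>i<m. \<Sum>j<m. (a i j)\<^sup>2) = (\<Sum>i<m. (a i i)\<^sup>2) + (\<Sum>i<m. \<Sum>j\<in>{..<m} - {i}. (a i j)\<^sup>2)"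
    unfolding sum.distrib[symmetric] by (intro sum.cong refl sum.remove) auto
  have "(\<Sum>i<m. (a i i - s / p)\<^sup>2) = (\<Sum>i<m. (a i i)\<^sup>2 - 2 * (s / p) * a i i + (s / p)\<^sup>2)"
    by (intro sum.cong refl) (simp add: power2_diff algebra_simps)
  also have "\<dots> = (\<Sum>i<m. (a i i)\<^sup>2) - 2 * (s / p) * t + real m * (s / p)\<^sup>2"
    unfolding t_def by (simp add: sum.distrib sum_subtractf sum_distrib_left)
  finally have 1: "p * (\<Sum>i<m. (a i i - s / p)\<^sup>2) = p * (\<Sum>i<m. (a i i)\<^sup>2) - 2 * s * t + real m / p * s\<^sup>2"
    using pos by (simp add: field_simps power2_eq_square)
  have 2: "w * (a m m - s / w)\<^sup>2 = w * (a m m)\<^sup>2 - 2 * s * a m m + 1 / w * s\<^sup>2"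
    using pos by (simp add: field_simps power2_eq_square)
  have "real m / p * s\<^sup>2 + 1 / w * s\<^sup>2 = (s * D) * s" unfolding D_def by (simp add: algebra_simps power2_eq_square)
  then have "real m / p * s\<^sup>2 + 1 / w * s\<^sup>2 = (t + a m m) * s" using sD by simp
  then have "p * (\<Sum>i<m. (a i i - s / p)\<^sup>2) + w * (a m m - s / w)\<^sup>2
      = p * (\<Sum>i<m. (a i i)\<^sup>2) + w * (a m m)\<^sup>2 - s * (t + a m m)"
    unfolding 1 2 by (simp add: algebra_simps)
  then have "D * (p * (\<Sum>i<m. (a i i - s / p)\<^sup>2) + w * (a m m - s / w)\<^sup>2)
      = D * (p * (\<Sum>i<m. (a i i)\<^sup>2) + w * (a m m)\<^sup>2) - (s * D) * (t + a m m)"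
    by (simp only: right_diff_distrib) (simp add: ac_simps)
  then show ?thesis
    unfolding weighted_gap_def D_def[symmetric] split sD
    by (simp add: t_def algebra_simps power2_eq_square)
qed

lemma weighted_gap_nonneg:
  assumes "0 < p" "0 < q" "0 < w"
  shows "0 \<le> weighted_gap m p q w a"
  unfolding weighted_gap_eq[OF assms refl] using assms
  by (intro mult_nonneg_nonneg add_nonneg_nonneg sum_nonneg) auto

lemma weighted_gap_eq_0:
  fixes a :: "nat \<Rightarrow> nat \<Rightarrow> real"
  assumes pos: "0 < p" "0 < q" "0 < w" and zero: "weighted_gap m p q w a = 0"
  obtains s where "(\<Sum>i<Suc m. a i i) = s * (real m / p + 1 / w)"
    "\<And>i j. i < m \<Longrightarrow> j < m \<Longrightarrow> i \<noteq> j \<Longrightarrow> a i j = 0" "\<And>i. i < m \<Longrightarrow> a i m = 0"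
    "\<And>i. i < m \<Longrightarrow> a i i = s / p" "a m m = s / w"
proof -
  define D where "D = real m / p + 1 / w"
  define s where "s = (\<Sum>i<Suc m. a i i) / D"
  have D: "D > 0" unfolding D_def using pos by (simp add: add_nonneg_pos)
  define A where "A = (\<Sum>i<m. \<Sum>j\<in>{..<m} - {i}. (a i j)\<^sup>2)"
  define B where "B = (\<Sum>i<m. (a i m)\<^sup>2)"
  define C where "C = (\<Sum>i<m. (a i i - s / p)\<^sup>2)"
  have "D * (p * A + q * B + p * C + w * (a m m - s / w)\<^sup>2) = 0"
    using zero weighted_gap_eq[OF pos, where a = a and s = s, OF s_def[unfolded D_def]] unfolding A_def B_def C_def D_def by simp
  then have 0: "p * A + q * B + p * C + w * (a m m - s / w)\<^sup>2 = 0" using D by simp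
  have nn: "0 \<le> A" "0 \<le> B" "0 \<le> C" unfolding A_def B_def C_def by (auto intro!: sum_nonneg)
  then have nn': "0 \<le> p * A" "0 \<le> q * B" "0 \<le> p * C" "0 \<le> w * (a m m - s / w)\<^sup>2" using pos by auto
  then have "p * A = 0" "q * B = 0" "p * C = 0" "w * (a m m - s / w)\<^sup>2 = 0" using 0 by linarith+
  then have z: "A = 0" "B = 0" "C = 0" "a m m = s / w" using pos by auto
  show thesis
  proof
    show "(\<Sum>i<Suc m. a i i) = s * (real m / p + 1 / w)" using D unfolding s_def D_def[symmetric] by simp
    show "a i m = 0" if "i < m" for i using z(2) that unfolding B_def by (simp add: sum_nonneg_eq_0_iff)
    show "a i i = s / p" if "i < m" for i using z(3) that unfolding C_def by (simp add: sum_nonneg_eq_0_iff)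
    show "a i j = 0" if "i < m" "j < m" "i \<noteq> j" for i j
      using z(1) that unfolding A_def by (simp add: sum_nonneg_eq_0_iff sum_nonneg)
  qed (rule z)
qed

section \<open>Immersions into space forms\<close>

locale space_form_immersion =
  isometric_immersion U G T H F
  for U :: "'e::euclidean_space set" and G :: "'e local_metric"
    and T :: "'f::euclidean_space set" and H :: "'f local_metric" and F +
  fixes c :: real
  assumes constant_curvature: "y \<in> T \<Longrightarrow> u \<noteq> v \<Longrightarrow> independent {u, v} \<Longrightarrow> sectional H y u v = c"
begin

lemma gauss_sectional:
  assumes x: "x \<in> U"
  shows "G x (riemann G x u v v) u = c * (G x u u * G x v v - (G x u v)\<^sup>2)
    + H (F x) (h x u u) (h x v v) - H (F x) (h x u v) (h x u v)"
proof -
  interpret N: ip_form "H (F x)" using amb.ip[OF image_in[OF x]] .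
  have "H (F x) (riemann H (F x) a b b) a = c * (H (F x) a a * H (F x) b b - (H (F x) a b)\<^sup>2)" for a b
    by (rule amb.constant_sectional[OF image_in[OF x]]) (rule constant_curvature[OF image_in[OF x]])
  then show ?thesis
    unfolding gauss_equation[OF x]
    by (simp add: isometric[OF x] second_ff_sym[OF x, of v u] N.sym[of "h x v v" "h x u u"])
qed

text \<open>Only the constant curvature part of the Gauss equation remains, and Parseval sums it
  over a frame. The factor is the same at all points and in all charts, as a single Einstein
  constant requires.\<close>

lemma totally_geodesic_imp_einstein:
  assumes x: "x \<in> U" and h: "\<And>u v. h x u v = 0"
  shows "ricci G x u v = c * (real DIM('e) - 1) * G x u v"
proof -
  interpret ip_form "G x" using dom.ip[OF x] .
  interpret N: ip_form "H (F x)" using amb.ip[OF image_in[OF x]] .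
  obtain e where e: "orthonormal_frame (G x) UNIV e" using frame_exists[OF subspace_UNIV] by blast
  have on: "G x (e i) (e i) = 1" if "i < DIM('e)" for i
    using frame_orthonormal[OF e] that unfolding orthonormal_def by simp
  have "ricci G x u u = c * (real DIM('e) - 1) * G x u u" for u
  proof -
    have "ricci G x u u = (\<Sum>i<DIM('e). c * (G x u u - (G x (e i) u)\<^sup>2))"
      unfolding dom.ricci_frame[OF x e] gauss_sectional[OF x] using on
      by (intro sum.cong) (simp_all add: h N.zero_left)
    also have "\<dots> = c * (\<Sum>i<DIM('e). G x u u - (G x u (e i))\<^sup>2)"
      unfolding sum_distrib_left by (intro sum.cong refl) (subst sym, rule refl)
    also have "\<dots> = c * (real DIM('e) * G x u u - G x u u)"
      using parseval[OF e, of u u] by (simp add: sum_subtractf power2_eq_square)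
    finally show ?thesis by (simp add: algebra_simps)
  qed
  then show ?thesis by (rule polarization[OF dom.bilinear_ricci[OF x] dom.ricci_sym[OF x]])
qed

definition codim :: "'e \<Rightarrow> nat" where
  "codim x = dim (normal_space F H x)"

text \<open>Exactly the choice made inside \<open>casorati_on\<close>, so Casorati curvatures unfold
  directly into the entries of \<open>shape\<close>.\<close>

definition normal_frame :: "'e \<Rightarrow> nat \<Rightarrow> 'f" where
  "normal_frame x = some_frame (H (F x)) (normal_space F H x)"

definition shape :: "'e \<Rightarrow> nat \<Rightarrow> 'e \<Rightarrow> 'e \<Rightarrow> real" where
  "shape x r u v = H (F x) (h x u v) (normal_frame x r)"

lemma normal_frame:
  assumes x: "x \<in> U"
  shows "orthonormal_frame (H (F x)) (normal_space F H x) (normal_frame x)"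
proof -
  interpret N: ip_form "H (F x)" using amb.ip[OF image_in[OF x]] .
  have "subspace (normal_space F H x)"
    unfolding subspace_def normal_space_def by (auto simp: N.zero_right N.add_right N.scale_right)
  then show ?thesis unfolding normal_frame_def by (rule N.some_frame)
qed

lemma bilinear_shape:
  assumes x: "x \<in> U"
  shows "bilinear (shape x r)"
proof -
  interpret N: ip_form "H (F x)" using amb.ip[OF image_in[OF x]] .
  note B = bilinear_second_ff[OF x]
  show ?thesis unfolding bilinear_def shape_def
    by (auto intro!: linearI simp: N.add_left N.scale_left bilinear_ladd[OF B] bilinear_radd[OF B]
        bilinear_lmul[OF B] bilinear_rmul[OF B])
qed

lemma shape_sym: "x \<in> U \<Longrightarrow> shape x r u v = shape x r v u"
  unfolding shape_def using second_ff_sym by metis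

lemma second_ff_inner:
  assumes x: "x \<in> U"
  shows "H (F x) (h x u v) (h x w z) = (\<Sum>r<codim x. shape x r u v * shape x r w z)"
proof -
  interpret N: ip_form "H (F x)" using amb.ip[OF image_in[OF x]] .
  have "h x u v \<in> normal_space F H x"
    unfolding normal_space_def using second_ff_normal[OF x] N.sym by auto
  then show ?thesis unfolding codim_def shape_def using N.parseval[OF normal_frame[OF x]] by blast
qed

lemma casorati_on_shape:
  "casorati_on F G H x L = 1 / real (dim L) *
    (\<Sum>r<codim x. \<Sum>i<dim L. \<Sum>j<dim L. (shape x r (some_frame (G x) L i) (some_frame (G x) L j))\<^sup>2)"
  unfolding casorati_on_def Let_def codim_def shape_def normal_frame_def ..

lemma casorati_frame:
  assumes x: "x \<in> U" and e: "orthonormal_frame (G x) UNIV e"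
  shows "real DIM('e) * casorati F G H x =
    (\<Sum>r<codim x. \<Sum>i<DIM('e). \<Sum>j<DIM('e). (shape x r (e i) (e j))\<^sup>2)"
proof -
  interpret ip_form "G x" using dom.ip[OF x] .
  show ?thesis
    unfolding casorati_def casorati_on_shape
    using form_norm_invariant[OF some_frame[OF subspace_UNIV] e bilinear_shape[OF x]] by simp
qed

lemma casorati_hyperplane:
  assumes x: "x \<in> U" and n: "DIM('e) = Suc m" "0 < m" and L: "L \<in> hyperplanes"
  shows "real m * casorati_on F G H x L =
    (\<Sum>r<codim x. \<Sum>i<m. \<Sum>j<m. (shape x r (some_frame (G x) L i) (some_frame (G x) L j))\<^sup>2)"
proof -
  have "dim L = m" using L n unfolding hyperplanes_def by auto
  then show ?thesis unfolding casorati_on_shape using n by simp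
qed

text \<open>\<open>scalar_curvature\<close> uses its own frame; invariance of trace and norm moves
  the result to any frame, in particular to one adapted to an extremal hyperplane.\<close>

lemma scalar_curvature_frame:
  assumes x: "x \<in> U" and n: "2 \<le> DIM('e)" and e: "orthonormal_frame (G x) UNIV e"
  shows "real DIM('e) * (real DIM('e) - 1) * (normalized_scalar_curvature G x - c) =
    (\<Sum>r<codim x. (\<Sum>i<DIM('e). shape x r (e i) (e i))\<^sup>2
       - (\<Sum>i<DIM('e). \<Sum>j<DIM('e). (shape x r (e i) (e j))\<^sup>2))"
proof -
  interpret ip_form "G x" using dom.ip[OF x] .
  let ?n = "DIM('e)"
  let ?e = "some_frame (G x) UNIV"
  have fe: "orthonormal_frame (G x) UNIV ?e" by (rule some_frame[OF subspace_UNIV])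
  have on: "i < ?n \<Longrightarrow> j < ?n \<Longrightarrow> G x (?e i) (?e j) = (if i = j then 1 else 0)" for i j
    using frame_orthonormal[OF fe] unfolding orthonormal_def by simp
  \<comment> \<open>The extrinsic part of the sectional curvature. It is symmetric and vanishes for
    \<open>i = j\<close>, so twice the sum over pairs is the sum over the full square.\<close>
  define f where "f = (\<lambda>i j. \<Sum>r<codim x. shape x r (?e i) (?e i) * shape x r (?e j) (?e j)
      - (shape x r (?e i) (?e j))\<^sup>2)"
  have fsym: "f i j = f j i" for i j
    unfolding f_def by (intro sum.cong refl) (simp add: shape_sym[OF x, of _ "?e i" "?e j"])
  have sec: "sectional G x (?e i) (?e j) = c + f i j" if "j < ?n" "i < j" for i j
    using that on[of i j] on[of i i] on[of j j]
    unfolding sectional_def gauss_sectional[OF x] second_ff_inner[OF x] f_def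
    by (simp add: sum_subtractf power2_eq_square)
  have "2 * scalar_curvature G x = 2 * (\<Sum>j<?n. \<Sum>i<j. c + f i j)"
    unfolding scalar_curvature_def Let_def using sec by (intro arg_cong[where f="\<lambda>t. 2 * t"] sum.cong refl) auto
  also have "\<dots> = (\<Sum>i<?n. \<Sum>j<?n. c + f i j) - (\<Sum>i<?n. c + f i i)"
    by (rule sum_triangle_sym) (simp add: fsym)
  also have "\<dots> = real ?n * (real ?n - 1) * c + (\<Sum>i<?n. \<Sum>j<?n. f i j)"
    by (simp add: f_def sum.distrib power2_eq_square algebra_simps)
  also have "(\<Sum>i<?n. \<Sum>j<?n. f i j) = (\<Sum>r<codim x. \<Sum>i<?n. \<Sum>j<?n.
      shape x r (?e i) (?e i) * shape x r (?e j) (?e j) - (shape x r (?e i) (?e j))\<^sup>2)"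
    unfolding f_def by (simp only: sum.swap[of _ _ "{..<codim x}"])
  also have "\<dots> = (\<Sum>r<codim x. (\<Sum>i<?n. shape x r (?e i) (?e i))\<^sup>2
       - (\<Sum>i<?n. \<Sum>j<?n. (shape x r (?e i) (?e j))\<^sup>2))"
    by (simp add: sum_subtractf power2_eq_square sum_product)
  also have "\<dots> = (\<Sum>r<codim x. (\<Sum>i<?n. shape x r (e i) (e i))\<^sup>2
       - (\<Sum>i<?n. \<Sum>j<?n. (shape x r (e i) (e j))\<^sup>2))"
    using form_trace_invariant[OF fe e bilinear_shape[OF x]] form_norm_invariant[OF fe e bilinear_shape[OF x]]
    by simp
  finally show ?thesis
    using n unfolding normalized_scalar_curvature_def by (simp add: field_simps)
qed

lemma ricci_shape:
  assumes x: "x \<in> U" and e: "orthonormal_frame (G x) UNIV e" and k: "k < DIM('e)"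
  shows "ricci G x (e k) (e k) = c * (real DIM('e) - 1)
    + (\<Sum>r<codim x. (\<Sum>i<DIM('e). shape x r (e i) (e i)) * shape x r (e k) (e k)
        - (\<Sum>i<DIM('e). (shape x r (e i) (e k))\<^sup>2))"
proof -
  interpret ip_form "G x" using dom.ip[OF x] .
  have on: "i < DIM('e) \<Longrightarrow> j < DIM('e) \<Longrightarrow> G x (e i) (e j) = (if i = j then 1 else 0)" for i j
    using frame_orthonormal[OF e] unfolding orthonormal_def by simp
  have "ricci G x (e k) (e k) = (\<Sum>i<DIM('e). (c - (if i = k then c else 0))
      + (\<Sum>r<codim x. shape x r (e i) (e i) * shape x r (e k) (e k) - (shape x r (e i) (e k))\<^sup>2))"
    unfolding dom.ricci_frame[OF x e] gauss_sectional[OF x] second_ff_inner[OF x] using on k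
    by (intro sum.cong) (auto simp: sum_subtractf power2_eq_square)
  also have "\<dots> = (\<Sum>i<DIM('e). c - (if i = k then c else 0)) + (\<Sum>r<codim x. \<Sum>i<DIM('e).
      shape x r (e i) (e i) * shape x r (e k) (e k) - (shape x r (e i) (e k))\<^sup>2)"
    by (simp add: sum.distrib sum.swap[of _ _ "{..<codim x}"])
  finally show ?thesis using k by (simp add: sum_subtractf sum_distrib_left algebra_simps)
qed

text \<open>Hyperplanes correspond to unit normals, and in terms of the normal
  \<open>casorati_on\<close> is a continuous function on a compact sphere. The passage is made in
  both directions, so extrema transfer.\<close>

lemma casorati_on_attained:
  assumes x: "x \<in> U" and n: "DIM('e) = Suc m" "0 < m"
  shows "\<exists>L\<in>hyperplanes. \<forall>L'\<in>hyperplanes. casorati_on F G H x L' \<le> casorati_on F G H x L"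
    and "\<exists>L\<in>hyperplanes. \<forall>L'\<in>hyperplanes. casorati_on F G H x L \<le> casorati_on F G H x L'"
proof -
  interpret ip_form "G x" using dom.ip[OF x] .
  obtain e where e: "orthonormal_frame (G x) UNIV e" using frame_exists[OF subspace_UNIV] by blast
  \<comment> \<open>Deleting the row and the column of \<open>v\<close> from the full squared norm
    removes the corner entry twice; the last term restores it once. A fixed frame \<open>e\<close>
    makes the dependence on \<open>v\<close> explicit.\<close>
  define \<Theta> where "\<Theta> = (\<lambda>v. ((\<Sum>r<codim x. (\<Sum>i<Suc m. \<Sum>j<Suc m. (shape x r (e i) (e j))\<^sup>2)
      - 2 * (\<Sum>i<Suc m. (shape x r v (e i))\<^sup>2) + (shape x r v v)\<^sup>2)) / real m)"
  let ?S = "{v. G x v v = 1}"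
  have eq: "casorati_on F G H x L = \<Theta> v"
    if L: "L \<in> hyperplanes" and f: "orthonormal_frame (G x) UNIV ((some_frame (G x) L)(m := v))" for L v
  proof -
    let ?e = "(some_frame (G x) L)(m := v)"
    have "(\<Sum>i<m. \<Sum>j<m. (shape x r (some_frame (G x) L i) (some_frame (G x) L j))\<^sup>2) =
        (\<Sum>i<Suc m. \<Sum>j<Suc m. (shape x r (e i) (e j))\<^sup>2)
        - 2 * (\<Sum>i<Suc m. (shape x r v (e i))\<^sup>2) + (shape x r v v)\<^sup>2" for r
    proof -
      have 1: "(\<Sum>i<Suc m. \<Sum>j<Suc m. (shape x r (e i) (e j))\<^sup>2) =
          (\<Sum>i<Suc m. \<Sum>j<Suc m. (shape x r (?e i) (?e j))\<^sup>2)"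
        using form_norm_invariant[OF e f bilinear_shape[OF x]] n by simp
      have 2: "(\<Sum>i<Suc m. (shape x r v (e i))\<^sup>2) = (\<Sum>i<Suc m. (shape x r v (?e i))\<^sup>2)"
        using form_row_invariant[OF e f bilinear_shape[OF x], of r v v] n by (simp add: power2_eq_square)
      have 3: "(\<Sum>i<m. (shape x r v (some_frame (G x) L i))\<^sup>2) = (\<Sum>i<m. (shape x r (some_frame (G x) L i) v)\<^sup>2)"
        by (intro sum.cong refl) (subst shape_sym[OF x], rule refl)
      show ?thesis
        unfolding 1 2 using sum_square_split[of "\<lambda>i j. shape x r (?e i) (?e j)" m, OF shape_sym[OF x]] 3
        by simp
    qed
    then have "real m * casorati_on F G H x L = real m * \<Theta> v"
      unfolding casorati_hyperplane[OF x n L] \<Theta>_def using n by simp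
    then show ?thesis using n by simp
  qed
  have fwd: "\<exists>v\<in>?S. casorati_on F G H x L = \<Theta> v" if L: "L \<in> hyperplanes" for L
  proof -
    have "subspace L" using L unfolding hyperplanes_def by blast
    from hyperplane_extend_frame[OF L some_frame[OF this]] eq[OF L] n show ?thesis
      by (metis (mono_tags) diff_Suc_1 mem_Collect_eq)
  qed
  have bwd: "\<exists>L\<in>hyperplanes. casorati_on F G H x L = \<Theta> v" if v: "v \<in> ?S" for v
  proof -
    obtain L where L: "L \<in> hyperplanes"
      "\<And>e. orthonormal_frame (G x) L e \<Longrightarrow> orthonormal_frame (G x) UNIV (e(DIM('e) - 1 := v))"
      using unit_normal_hyperplane v by blast
    have "subspace L" using L unfolding hyperplanes_def by blast
    then show ?thesis using eq[OF L(1)] L(2)[OF some_frame] n L(1) by auto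
  qed
  have "e 0 \<in> ?S"
    using frame_orthonormal[OF e] n unfolding orthonormal_def by simp
  then have ne: "?S \<noteq> {}" by blast
  have cont: "continuous_on ?S \<Theta>"
    unfolding \<Theta>_def
    by (intro continuous_intros bilinear_continuous_on_compose[OF _ _ bilinear_shape[OF x]])
      (use n in auto)
  show "\<exists>L\<in>hyperplanes. \<forall>L'\<in>hyperplanes. casorati_on F G H x L' \<le> casorati_on F G H x L"
    using continuous_attains_sup[OF compact_unit_sphere ne cont] fwd bwd by metis
  show "\<exists>L\<in>hyperplanes. \<forall>L'\<in>hyperplanes. casorati_on F G H x L \<le> casorati_on F G H x L'"
    using continuous_attains_inf[OF compact_unit_sphere ne cont] fwd bwd by metis
qed

text \<open>A vanishing total gap forces every shape form to be \<open>diag(s/p, \<dots>, s/p, s/w)\<close> in the adapted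
  frame; comparing the Ricci curvatures of the two kinds of frame vectors then kills \<open>s\<close>.\<close>

lemma einstein_gap_zero_imp_totally_geodesic:
  assumes x: "x \<in> U" and n: "DIM('e) = Suc m" "2 \<le> m"
    and e: "orthonormal_frame (G x) UNIV e"
    and wpos: "0 < p" "0 < q" "0 < w" and ne: "p \<noteq> w"
    and gap: "(\<Sum>r<codim x. weighted_gap m p q w (\<lambda>i j. shape x r (e i) (e j))) = 0"
    and einstein: "\<And>u v. ricci G x u v = \<mu> * G x u v"
  shows "h x u v = 0"
proof -
  interpret ip_form "G x" using dom.ip[OF x] .
  interpret N: ip_form "H (F x)" using amb.ip[OF image_in[OF x]] .
  define D where "D = real m / p + 1 / w"
  have gap0: "weighted_gap m p q w (\<lambda>i j. shape x r (e i) (e j)) = 0" if "r < codim x" for r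
    using gap that weighted_gap_nonneg[OF wpos] by (simp add: sum_nonneg_eq_0_iff)
  \<comment> \<open>Bundles the conclusions about one normal direction, so that the scalars for all
    directions can be chosen as one function \<open>s\<close>.\<close>
  define shaped where "shaped = (\<lambda>r s. (\<Sum>i<Suc m. shape x r (e i) (e i)) = s * D
      \<and> (\<forall>i<m. \<forall>j<m. i \<noteq> j \<longrightarrow> shape x r (e i) (e j) = 0) \<and> (\<forall>i<m. shape x r (e i) (e m) = 0)
      \<and> (\<forall>i<m. shape x r (e i) (e i) = s / p) \<and> shape x r (e m) (e m) = s / w)"
  have "\<exists>s. shaped r s" if "r < codim x" for r
    by (rule weighted_gap_eq_0[OF wpos gap0[OF that]]) (auto simp: shaped_def D_def)
  then obtain s where "\<And>r. r < codim x \<Longrightarrow> shaped r (s r)" by metis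
  then have s: "\<And>r. r < codim x \<Longrightarrow> (\<Sum>i<Suc m. shape x r (e i) (e i)) = s r * D"
      "\<And>r i j. r < codim x \<Longrightarrow> i < m \<Longrightarrow> j < m \<Longrightarrow> i \<noteq> j \<Longrightarrow> shape x r (e i) (e j) = 0"
      "\<And>r i. r < codim x \<Longrightarrow> i < m \<Longrightarrow> shape x r (e i) (e m) = 0"
      "\<And>r i. r < codim x \<Longrightarrow> i < m \<Longrightarrow> shape x r (e i) (e i) = s r / p"
      "\<And>r. r < codim x \<Longrightarrow> shape x r (e m) (e m) = s r / w"
    unfolding shaped_def by blast+
  define V where "V = (\<Sum>r<codim x. (s r)\<^sup>2)"
  have row0: "(\<Sum>i<Suc m. (shape x r (e i) (e 0))\<^sup>2) = (s r / p)\<^sup>2" if r: "r < codim x" for r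
  proof -
    have "(\<Sum>i<Suc m. (shape x r (e i) (e 0))\<^sup>2) = (\<Sum>i<Suc m. if i = 0 then (s r / p)\<^sup>2 else 0)"
      using s(2-4)[OF r] n(2) shape_sym[OF x, of r "e m" "e 0"] by (intro sum.cong) (auto simp: less_Suc_eq)
    then show ?thesis by simp
  qed
  have rowm: "(\<Sum>i<Suc m. (shape x r (e i) (e m))\<^sup>2) = (s r / w)\<^sup>2" if r: "r < codim x" for r
    using s(3,5)[OF r] by simp
  have on: "G x (e k) (e k) = 1" if "k < Suc m" for k
    using frame_orthonormal[OF e] that n unfolding orthonormal_def by simp
  have "\<mu> = c * real m + (\<Sum>r<codim x. s r * D * (s r / p) - (s r / p)\<^sup>2)"
    using ricci_shape[OF x e, of 0] einstein[of "e 0" "e 0"] on[of 0] n s(1,4) row0 by simp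
  also have "(\<Sum>r<codim x. s r * D * (s r / p) - (s r / p)\<^sup>2) = (D / p - 1 / p\<^sup>2) * V"
    unfolding V_def sum_distrib_left by (intro sum.cong refl) (simp add: field_simps power2_eq_square)
  finally have 0: "\<mu> = c * real m + (D / p - 1 / p\<^sup>2) * V" .
  have "\<mu> = c * real m + (\<Sum>r<codim x. s r * D * (s r / w) - (s r / w)\<^sup>2)"
    using ricci_shape[OF x e, of m] einstein[of "e m" "e m"] on[of m] n s(1,5) rowm by simp
  also have "(\<Sum>r<codim x. s r * D * (s r / w) - (s r / w)\<^sup>2) = (D / w - 1 / w\<^sup>2) * V"
    unfolding V_def sum_distrib_left by (intro sum.cong refl) (simp add: field_simps power2_eq_square)
  finally have "((D / p - 1 / p\<^sup>2) - (D / w - 1 / w\<^sup>2)) * V = 0" using 0 by (simp add: algebra_simps)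
  \<comment> \<open>The difference factors as \<open>1 / p - 1 / w\<close> times
    \<open>D - 1 / p - 1 / w\<close>, and the latter is \<open>(real m - 1) / p\<close>. It is
    nonzero because the weights differ and the dimension is at least 3.\<close>
  moreover have "(D / p - 1 / p\<^sup>2) - (D / w - 1 / w\<^sup>2) = (1 / p - 1 / w) * ((real m - 1) / p)"
    unfolding D_def using wpos by (simp add: field_simps power2_eq_square)
  moreover have "(1 / p - 1 / w) * ((real m - 1) / p) \<noteq> 0" 
    using wpos ne n(2) by (simp add: divide_eq_eq eq_divide_eq)
  ultimately have "V = 0" by simp
  then have s0: "s r = 0" if "r < codim x" for r
    using that unfolding V_def by (simp add: sum_nonneg_eq_0_iff)
  have "shape x r (e i) (e j) = 0" if "r < codim x" "i < Suc m" "j < Suc m" for r i j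
    using s(2-5)[OF that(1)] s0[OF that(1)] that(2,3) shape_sym[OF x, of r "e m" "e j"]
    by (cases "i = j") (auto simp: less_Suc_eq)
  then have hij: "h x (e i) (e j) = 0" if "i < Suc m" "j < Suc m" for i j
    using that second_ff_inner[OF x, of "e i" "e j" "e i" "e j"] N.self_eq_0_iff by simp
  have "h x u v = h x (\<Sum>i<Suc m. G x u (e i) *\<^sub>R e i) (\<Sum>i<Suc m. G x v (e i) *\<^sub>R e i)"
    using frame_expand[OF e, of u] frame_expand[OF e, of v] n by simp
  also have "\<dots> = 0"
    unfolding bilinear_sum[OF bilinear_second_ff[OF x]] using hij
    by (intro sum.neutral) (auto simp: bilinear_lmul[OF bilinear_second_ff[OF x]] bilinear_rmul[OF bilinear_second_ff[OF x]]
        simp del: lessThan_Suc)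
  finally show ?thesis .
qed

lemma adapted_frame:
  assumes x: "x \<in> U" and n: "DIM('e) = Suc m" "0 < m" and L: "L \<in> hyperplanes"
  obtains e where "orthonormal_frame (G x) UNIV e"
    "real m * casorati_on F G H x L = (\<Sum>r<codim x. \<Sum>i<m. \<Sum>j<m. (shape x r (e i) (e j))\<^sup>2)"
proof -
  interpret ip_form "G x" using dom.ip[OF x] .
  have "subspace L" using L unfolding hyperplanes_def by blast
  then obtain v where "orthonormal_frame (G x) UNIV ((some_frame (G x) L)(m := v))"
    using hyperplane_extend_frame[OF L some_frame] n by (metis diff_Suc_1)
  then show ?thesis using that casorati_hyperplane[OF x n L] by simp
qed

section \<open>The two equality cases\<close>

text \<open>With n = m + 1, multiplying the equality by n(n-1) turns the coefficients 2 and
  (2n-1)/(2n) into 2m for \<open>S\<close> and (2m+1)/2 for \<open>SL\<close>. Moving everything to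
  one side leaves (2m+1)(S - SL/2) minus the squared traces, and \<open>S - SL / 2\<close> has
  weights 1/2, 2, 1 on the block, the last column and the corner.\<close>

lemma hat_ideal_einstein:
  assumes x: "x \<in> U" and n: "DIM('e) = Suc m" "2 \<le> m"
    and ideal: "normalized_scalar_curvature G x = delta_casorati_hat F G H x + c"
    and einstein: "\<And>u v. ricci G x u v = \<mu> * G x u v"
  shows "h x u v = 0"
proof -
  have m: "0 < m" using n by simp
  obtain L where L: "L \<in> hyperplanes"
    "\<And>L'. L' \<in> hyperplanes \<Longrightarrow> casorati_on F G H x L' \<le> casorati_on F G H x L"
    using casorati_on_attained(1)[OF x n(1) m] by blast
  have sup: "(SUP L\<in>hyperplanes. casorati_on F G H x L) = casorati_on F G H x L"
    using L by (intro cSup_eq_maximum) auto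
  obtain e where e: "orthonormal_frame (G x) UNIV e"
    and cL: "real m * casorati_on F G H x L = (\<Sum>r<codim x. \<Sum>i<m. \<Sum>j<m. (shape x r (e i) (e j))\<^sup>2)"
    using adapted_frame[OF x n(1) m L(1)] by blast
  define S where "S = (\<lambda>r. \<Sum>i<Suc m. \<Sum>j<Suc m. (shape x r (e i) (e j))\<^sup>2)"
  define SL where "SL = (\<lambda>r. \<Sum>i<m. \<Sum>j<m. (shape x r (e i) (e j))\<^sup>2)"
  define t where "t = (\<lambda>r. \<Sum>i<Suc m. shape x r (e i) (e i))"
  have gap: "weighted_gap m (1/2) 2 1 (\<lambda>i j. shape x r (e i) (e j))
      = (2 * real m + 1) * (S r - SL r / 2) - (t r)\<^sup>2" for r
    unfolding weighted_gap_def S_def t_def sum_square_split[of "\<lambda>i j. shape x r (e i) (e j)" m, OF shape_sym[OF x]]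
    by (simp add: SL_def field_simps)
  have C: "(real m + 1) * casorati F G H x = sum S {..<codim x}"
    using casorati_frame[OF x e] n unfolding S_def by (simp add: add.commute)
  have \<rho>: "(real m + 1) * real m * (normalized_scalar_curvature G x - c) = (\<Sum>r<codim x. (t r)\<^sup>2 - S r)"
    using scalar_curvature_frame[OF x _ e] n unfolding S_def t_def by (simp add: add.commute)
  have "(real m + 1) * real m * (normalized_scalar_curvature G x - c) =
      2 * real m * ((real m + 1) * casorati F G H x) - (2 * real m + 1) / 2 * (real m * casorati_on F G H x L)"
    unfolding ideal delta_casorati_hat_def sup n(1) by (simp add: field_simps)
  moreover have "(\<Sum>r<codim x. weighted_gap m (1/2) 2 1 (\<lambda>i j. shape x r (e i) (e j)))
      = (2 * real m + 1) * (sum S {..<codim x} - sum SL {..<codim x} / 2) - (\<Sum>r<codim x. (t r)\<^sup>2)"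
    by (simp only: gap sum_subtractf sum_distrib_left[symmetric] sum_divide_distrib[symmetric])
  ultimately have "(\<Sum>r<codim x. weighted_gap m (1/2) 2 1 (\<lambda>i j. shape x r (e i) (e j))) = 0"
    unfolding \<rho> C cL SL_def[symmetric] by (simp add: sum_subtractf field_simps)
  then show ?thesis
    by (intro einstein_gap_zero_imp_totally_geodesic[OF x n e _ _ _ _ _ einstein]) auto
qed

text \<open>Here the factor n(n-1) yields m/2 for \<open>S\<close> and (m+2)/2 for
  \<open>SL\<close>. The gap is (m+2)/2 times \<open>S + SL\<close>, minus the squared traces; half
  of \<open>S + SL\<close> has weights 1, 1, 1/2.\<close>

lemma ideal_einstein:
  assumes x: "x \<in> U" and n: "DIM('e) = Suc m" "2 \<le> m"
    and ideal: "normalized_scalar_curvature G x = delta_casorati F G H x + c"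
    and einstein: "\<And>u v. ricci G x u v = \<mu> * G x u v"
  shows "h x u v = 0"
proof -
  have m: "0 < m" using n by simp
  obtain L where L: "L \<in> hyperplanes"
    "\<And>L'. L' \<in> hyperplanes \<Longrightarrow> casorati_on F G H x L \<le> casorati_on F G H x L'"
    using casorati_on_attained(2)[OF x n(1) m] by blast
  have inf: "(INF L\<in>hyperplanes. casorati_on F G H x L) = casorati_on F G H x L"
    using L by (intro cInf_eq_minimum) auto
  obtain e where e: "orthonormal_frame (G x) UNIV e"
    and cL: "real m * casorati_on F G H x L = (\<Sum>r<codim x. \<Sum>i<m. \<Sum>j<m. (shape x r (e i) (e j))\<^sup>2)"
    using adapted_frame[OF x n(1) m L(1)] by blast
  define S where "S = (\<lambda>r. \<Sum>i<Suc m. \<Sum>j<Suc m. (shape x r (e i) (e j))\<^sup>2)"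
  define SL where "SL = (\<lambda>r. \<Sum>i<m. \<Sum>j<m. (shape x r (e i) (e j))\<^sup>2)"
  define t where "t = (\<lambda>r. \<Sum>i<Suc m. shape x r (e i) (e i))"
  have gap: "weighted_gap m 1 1 (1/2) (\<lambda>i j. shape x r (e i) (e j))
      = (real m + 2) / 2 * (S r + SL r) - (t r)\<^sup>2" for r
    unfolding weighted_gap_def S_def t_def sum_square_split[of "\<lambda>i j. shape x r (e i) (e j)" m, OF shape_sym[OF x]]
    by (simp add: SL_def field_simps)
  have C: "(real m + 1) * casorati F G H x = sum S {..<codim x}"
    using casorati_frame[OF x e] n unfolding S_def by (simp add: add.commute)
  have \<rho>: "(real m + 1) * real m * (normalized_scalar_curvature G x - c) = (\<Sum>r<codim x. (t r)\<^sup>2 - S r)"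
    using scalar_curvature_frame[OF x _ e] n unfolding S_def t_def by (simp add: add.commute)
  have "(real m + 1) * real m * (normalized_scalar_curvature G x - c) =
      real m / 2 * ((real m + 1) * casorati F G H x) + (real m + 2) / 2 * (real m * casorati_on F G H x L)"
    unfolding ideal delta_casorati_def inf n(1) by (simp add: field_simps)
  moreover have "(\<Sum>r<codim x. weighted_gap m 1 1 (1/2) (\<lambda>i j. shape x r (e i) (e j)))
      = (real m + 2) / 2 * (sum S {..<codim x} + sum SL {..<codim x}) - (\<Sum>r<codim x. (t r)\<^sup>2)"
    by (simp only: gap sum_subtractf sum.distrib sum_distrib_left[symmetric])
  ultimately have "(\<Sum>r<codim x. weighted_gap m 1 1 (1/2) (\<lambda>i j. shape x r (e i) (e j))) = 0"
    unfolding \<rho> C cL SL_def[symmetric] by (simp add: sum_subtractf field_simps)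
  then show ?thesis
    by (intro einstein_gap_zero_imp_totally_geodesic[OF x n e _ _ _ _ _ einstein]) auto
qed

end

section \<open>Charts\<close>

lemma chart_inj_on: "is_chart \<kappa> \<Longrightarrow> inj_on (snd \<kappa>) (fst \<kappa>)"
  unfolding is_chart_def homeomorphism_def by (metis inj_on_inverseI)

lemma open_rep_domain:
  assumes \<kappa>: "is_chart \<kappa>" and \<kappa>': "is_chart \<kappa>'" and f: "continuous_on (fst \<kappa>) f"
  shows "open (rep_domain \<kappa> \<kappa>' f)"
proof -
  have o: "open (fst \<kappa>)" "open (snd \<kappa> ` fst \<kappa>)" "open (fst \<kappa>')" using \<kappa> \<kappa>' unfolding is_chart_def by auto
  obtain \<psi> where h: "homeomorphism (fst \<kappa>) (snd \<kappa> ` fst \<kappa>) (snd \<kappa>) \<psi>" using \<kappa> unfolding is_chart_def by blast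
  have "open (f -` fst \<kappa>' \<inter> fst \<kappa>)" using continuous_on_open_vimage[OF o(1)] f o(3) by blast
  then have "openin (top_of_set (fst \<kappa>)) {q \<in> fst \<kappa>. f q \<in> fst \<kappa>'}"
    using o(1) by (auto simp: openin_open_eq vimage_def Int_def conj_commute)
  then have "openin (top_of_set (snd \<kappa> ` fst \<kappa>)) (rep_domain \<kappa> \<kappa>' f)"
    unfolding rep_domain_def by (rule homeomorphism_imp_open_map[OF h])
  then show ?thesis using o(2) by (simp add: openin_open_eq)
qed

lemma chart_rep_image: "is_chart \<kappa> \<Longrightarrow> chart_rep \<kappa> \<kappa>' f ` rep_domain \<kappa> \<kappa>' f \<subseteq> snd \<kappa>' ` fst \<kappa>'"
  unfolding chart_rep_def rep_domain_def by (auto simp: inv_into_f_f chart_inj_on)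

lemma rep_domain_subset: "rep_domain \<kappa> \<kappa>' f \<subseteq> snd \<kappa> ` fst \<kappa>"
  unfolding rep_domain_def by auto

text \<open>The passage from the global definitions to the local theory: the domain consists of the
  coordinates of points that \<open>f\<close> sends into the second chart, while the target is the
  whole image of that chart.\<close>

lemma space_form_immersion_chart:
  assumes N: "real_space_form B gN c" and M: "riemannian_submanifold A g B gN f"
    and \<kappa>: "\<kappa> \<in> A" and \<kappa>': "\<kappa>' \<in> B"
  shows "space_form_immersion (rep_domain \<kappa> \<kappa>' f) (g \<kappa>) (snd \<kappa>' ` fst \<kappa>') (gN \<kappa>') (chart_rep \<kappa> \<kappa>' f) c"
proof -
  have R: "riemannian_manifold A g" "riemannian_manifold B gN" "smooth_map A B f"
    using M unfolding riemannian_submanifold_def by auto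
  have ch: "is_chart \<kappa>" "is_chart \<kappa>'"
    using R \<kappa> \<kappa>' unfolding riemannian_manifold_def smooth_atlas_def by auto
  have "continuous_on (manifold_carrier A) f" using R(3) unfolding smooth_map_def by blast
  then have "continuous_on (fst \<kappa>) f"
    by (rule continuous_on_subset) (use \<kappa> in \<open>auto simp: manifold_carrier_def\<close>)
  note op = open_rep_domain[OF ch this]
  show ?thesis
  proof (unfold_locales)
    show "open (rep_domain \<kappa> \<kappa>' f)" by (rule op)
    show "open (snd \<kappa>' ` fst \<kappa>')" using ch(2) unfolding is_chart_def by blast
    show "inner_product_form (g \<kappa> x)" if "x \<in> rep_domain \<kappa> \<kappa>' f" for x
      using subsetD[OF rep_domain_subset that] R(1) \<kappa> unfolding riemannian_manifold_def by blast
    show "inner_product_form (gN \<kappa>' y)" if "y \<in> snd \<kappa>' ` fst \<kappa>'" for y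
      using that R(2) \<kappa>' unfolding riemannian_manifold_def by blast
    show "smooth_on (rep_domain \<kappa> \<kappa>' f) (\<lambda>x. g \<kappa> x u v)" for u v
      using R(1) \<kappa> smooth_on_subset[OF _ rep_domain_subset] unfolding riemannian_manifold_def by blast
    show "smooth_on (snd \<kappa>' ` fst \<kappa>') (\<lambda>x. gN \<kappa>' x u v)" for u v
      using R(2) \<kappa>' unfolding riemannian_manifold_def by blast
    show "smooth_on (rep_domain \<kappa> \<kappa>' f) (chart_rep \<kappa> \<kappa>' f)"
      using R(3) \<kappa> \<kappa>' unfolding smooth_map_def by blast
    show "chart_rep \<kappa> \<kappa>' f ` rep_domain \<kappa> \<kappa>' f \<subseteq> snd \<kappa>' ` fst \<kappa>'" by (rule chart_rep_image[OF ch(1)])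
    show "g \<kappa> x u v = gN \<kappa>' (chart_rep \<kappa> \<kappa>' f x) (frechet_derivative (chart_rep \<kappa> \<kappa>' f) (at x) u)
        (frechet_derivative (chart_rep \<kappa> \<kappa>' f) (at x) v)" if "x \<in> rep_domain \<kappa> \<kappa>' f" for x u v
      using that M \<kappa> \<kappa>' unfolding riemannian_submanifold_def by blast
    show "sectional (gN \<kappa>') y u v = c" if "y \<in> snd \<kappa>' ` fst \<kappa>'" "u \<noteq> v" "independent {u, v}" for y u v
      using that N \<kappa>' unfolding real_space_form_def by blast
  qed
qed

text \<open>The Einstein condition mentions charts of the submanifold only; this supplies an ambient
  chart around the image point, where the Gauss equation can be applied.\<close>

lemma rep_domain_covers:
  assumes "smooth_map A B f" "\<kappa> \<in> A" "x \<in> snd \<kappa> ` fst \<kappa>"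
  obtains \<kappa>' where "\<kappa>' \<in> B" "x \<in> rep_domain \<kappa> \<kappa>' f"
proof -
  obtain q where q: "q \<in> fst \<kappa>" "x = snd \<kappa> q" using assms(3) by blast
  then have "f q \<in> manifold_carrier B"
    using assms(1,2) unfolding smooth_map_def manifold_carrier_def by blast
  then show ?thesis using that q unfolding manifold_carrier_def rep_domain_def by blast
qed

theorem theorem5p3:
  fixes A :: "('a::{t2_space,second_countable_topology}, 'e::euclidean_space) chart set"
    and g :: "('a, 'e) metric"
    and B :: "('b::{t2_space,second_countable_topology}, 'f::euclidean_space) chart set"
    and gN :: "('b, 'f) metric"
    and f :: "'a \<Rightarrow> 'b"
    and c :: real
    and n p :: nat
  assumes "n \<ge> 3" and "p \<ge> 1"
    and "DIM('e) = n" and "DIM('f) = n + p"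
    and "real_space_form B gN c"
    and "riemannian_submanifold A g B gN f"
  shows "(casorati_ideal_hat A g B gN f c \<longrightarrow>
            (einstein_manifold A g \<longleftrightarrow> totally_geodesic A g B gN f)) \<and>
         (casorati_ideal A g B gN f c \<longrightarrow>
            (einstein_manifold A g \<longleftrightarrow> totally_geodesic A g B gN f))"
proof -
  note local = space_form_immersion_chart[OF assms(5,6)]
  obtain m where m: "DIM('e) = Suc m" "2 \<le> m" using assms(1,3) by (cases n) auto
  \<comment> \<open>This implication serves both parts of the theorem.\<close>
  have "einstein_manifold A g" if tg: "totally_geodesic A g B gN f"
    unfolding einstein_manifold_def
  proof (intro exI ballI allI)
    fix \<kappa> x u v assume \<kappa>: "\<kappa> \<in> A" and x: "x \<in> snd \<kappa> ` fst \<kappa>"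
    have "smooth_map A B f" using assms(6) unfolding riemannian_submanifold_def by blast
    then obtain \<kappa>' where \<kappa>': "\<kappa>' \<in> B" "x \<in> rep_domain \<kappa> \<kappa>' f" using rep_domain_covers \<kappa> x by blast
    then show "ricci (g \<kappa>) x u v = c * (real DIM('e) - 1) * g \<kappa> x u v"
      using space_form_immersion.totally_geodesic_imp_einstein[OF local[OF \<kappa> \<kappa>'(1)] \<kappa>'(2)] tg \<kappa>
      unfolding totally_geodesic_def by blast
  qed
  moreover have "totally_geodesic A g B gN f" if E: "einstein_manifold A g" and I: "casorati_ideal_hat A g B gN f c"
    unfolding totally_geodesic_def
  proof (intro ballI allI)
    fix \<kappa> \<kappa>' x u v assume \<kappa>: "\<kappa> \<in> A" "\<kappa>' \<in> B" and x: "x \<in> rep_domain \<kappa> \<kappa>' f"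
    obtain \<mu> where "ricci (g \<kappa>) x u v = \<mu> * g \<kappa> x u v" for u v
      using E \<kappa>(1) subsetD[OF rep_domain_subset x] unfolding einstein_manifold_def by blast
    moreover have "normalized_scalar_curvature (g \<kappa>) x = delta_casorati_hat (chart_rep \<kappa> \<kappa>' f) (g \<kappa>) (gN \<kappa>') x + c"
      using I \<kappa> x unfolding casorati_ideal_hat_def by blast
    ultimately show "second_ff (chart_rep \<kappa> \<kappa>' f) (g \<kappa>) (gN \<kappa>') x u v = 0"
      using space_form_immersion.hat_ideal_einstein[OF local[OF \<kappa>] x m] by blast
  qed
  moreover have "totally_geodesic A g B gN f" if E: "einstein_manifold A g" and I: "casorati_ideal A g B gN f c"
    unfolding totally_geodesic_def
  proof (intro ballI allI)
    fix \<kappa> \<kappa>' x u v assume \<kappa>: "\<kappa> \<in> A" "\<kappa>' \<in> B" and x: "x \<in> rep_domain \<kappa> \<kappa>' f"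
    obtain \<mu> where "ricci (g \<kappa>) x u v = \<mu> * g \<kappa> x u v" for u v
      using E \<kappa>(1) subsetD[OF rep_domain_subset x] unfolding einstein_manifold_def by blast
    moreover have "normalized_scalar_curvature (g \<kappa>) x = delta_casorati (chart_rep \<kappa> \<kappa>' f) (g \<kappa>) (gN \<kappa>') x + c"
      using I \<kappa> x unfolding casorati_ideal_def by blast
    ultimately show "second_ff (chart_rep \<kappa> \<kappa>' f) (g \<kappa>) (gN \<kappa>') x u v = 0"
      using space_form_immersion.ideal_einstein[OF local[OF \<kappa>] x m] by blast
  qed
  ultimately show ?thesis by blast
qed

end
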